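(* Let $n\ge2$ be an integer. (i) If $p_i\in\mathbb R\langle\mathcal X\rangle$, for $i\in\{1,\dots,4\}$, are multilinear polynomials with $p_i(\mathbb H)\notin\{\{0\},\mathbb R\}$ for each $i$, then $$\mathrm{SL}_n(\mathbb H)\subseteq\left\{A_1A_2A_1^{-1}A_2^{-1}A_3A_4A_3^{-1}A_4^{-1}\ \middle|\ A_i\in p_i(\mathrm{M}_n(\mathbb H))\right\}.$$ (ii) If $p_i\in\mathbb R\langle\mathcal X\rangle$, for $i\in\{1,\dots,8\}$, are multilinear polynomials with $p_i(\mathbb H)\notin\{\{0\},\mathbb R\}$ for each $i$, then every matrix $A\in\mathrm{M}_n(\mathbb H)$ can be expressed as $$A=A_1A_2A_1^{-1}A_2^{-1}A_3A_4A_3^{-1}A_4^{-1}-A_5A_6A_5^{-1}A_6^{-1}A_7A_8A_7^{-1}A_8^{-1}$$ for some $A_i\in p_i(\mathrm{M}_n(\mathbb H))$.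
   Context: $\mathbb H$ is the real quaternion division ring, with center $\mathbb R$. $\mathbb R\langle\mathcal X\rangle$ is the free associative $\mathbb R$-algebra on noncommuting variables $x_1,x_2,\dots$. A multilinear polynomial has the form $p=\sum_{\sigma\in S_m}\lambda_\sigma x_{\sigma(1)}\cdots x_{\sigma(m)}$, with $m\ge1$ and $\lambda_\sigma\in\mathbb R$. For an $\mathbb R$-algebra $\mathcal A$, $p(\mathcal A)=\{p(a_1,\dots,a_m)\mid a_i\in\mathcal A\}$. $\mathrm{SL}_n(\mathbb H)$ is the subgroup of $\mathrm{GL}_n(\mathbb H)$ generated by all multiplicative commutators $ABA^{-1}B^{-1}$, $A,B\in\mathrm{GL}_n(\mathbb H)$ (equivalently, the kernel of the Dieudonné determinant). In the expressions above the matrices $A_i$ whose inverses appear are invertible. *)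

theory Defs
  imports
    Complex_Main
    "HOL-Library.Poly_Mapping"
    "HOL-Combinatorics.Permutations"
    "HOL-Algebra.Generated_Groups"
    "HOL-Algebra.Module"
    "Jordan_Normal_Form.Matrix"
begin

section \<open>The real quaternions\<close>

datatype quat = Quat (qre: real) (qi: real) (qj: real) (qk: real)

lemma quat_eq_iff:
  "x = y \<longleftrightarrow> qre x = qre y \<and> qi x = qi y \<and> qj x = qj y \<and> qk x = qk y"
  by (cases x; cases y) simp

instantiation quat :: real_div_algebra
begin

definition zero_quat :: quat where
  "0 = Quat 0 0 0 0"

definition one_quat :: quat where
  "1 = Quat 1 0 0 0"

definition plus_quat :: "quat \<Rightarrow> quat \<Rightarrow> quat" where
  "x + y = Quat (qre x + qre y) (qi x + qi y) (qj x + qj y) (qk x + qk y)"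

definition uminus_quat :: "quat \<Rightarrow> quat" where
  "- x = Quat (- qre x) (- qi x) (- qj x) (- qk x)"

definition minus_quat :: "quat \<Rightarrow> quat \<Rightarrow> quat" where
  "x - y = Quat (qre x - qre y) (qi x - qi y) (qj x - qj y) (qk x - qk y)"

definition times_quat :: "quat \<Rightarrow> quat \<Rightarrow> quat" where
  "x * y = Quat
     (qre x * qre y - qi x * qi y - qj x * qj y - qk x * qk y)
     (qre x * qi y + qi x * qre y + qj x * qk y - qk x * qj y)
     (qre x * qj y - qi x * qk y + qj x * qre y + qk x * qi y)
     (qre x * qk y + qi x * qj y - qj x * qi y + qk x * qre y)"

definition scaleR_quat :: "real \<Rightarrow> quat \<Rightarrow> quat" where
  "r *\<^sub>R x = Quat (r * qre x) (r * qi x) (r * qj x) (r * qk x)"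

definition inverse_quat :: "quat \<Rightarrow> quat" where
  "inverse x =
     inverse ((qre x)\<^sup>2 + (qi x)\<^sup>2 + (qj x)\<^sup>2 + (qk x)\<^sup>2) *\<^sub>R Quat (qre x) (- qi x) (- qj x) (- qk x)"

definition divide_quat :: "quat \<Rightarrow> quat \<Rightarrow> quat" where
  "x div y = x * inverse (y :: quat)"

lemmas quat_ops = zero_quat_def one_quat_def plus_quat_def uminus_quat_def minus_quat_def
  times_quat_def scaleR_quat_def

instance
proof
  fix x :: quat
  let ?N = "(qre x)\<^sup>2 + (qi x)\<^sup>2 + (qj x)\<^sup>2 + (qk x)\<^sup>2"
  assume "x \<noteq> 0"
  then have "?N \<noteq> 0"
    by (auto simp: quat_eq_iff quat_ops add_nonneg_eq_0_iff)
  then have "inverse ?N * ?N = 1"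
    by simp
  then show "inverse x * x = 1" "x * inverse x = 1"
    by (simp_all add: inverse_quat_def quat_ops algebra_simps power2_eq_square)
qed (simp_all add: quat_eq_iff quat_ops inverse_quat_def divide_quat_def algebra_simps)

end

section \<open>The free algebra and multilinear polynomials\<close>

text \<open>
  An element of the free algebra \<open>\<real>\<langle>\<X>\<rangle>\<close> is a finitely supported
  family of real coefficients indexed by words; the word \<open>[i, j, \<dots>]\<close> stands for
  the monomial \<open>x\<^sub>i x\<^sub>j \<dots>\<close>.
\<close>

type_synonym free_alg = "nat list \<Rightarrow>\<^sub>0 real"

definition multilinear :: "free_alg \<Rightarrow> bool" where
  "multilinear p \<longleftrightarrow> (\<exists>m\<ge>1. \<exists>c :: (nat \<Rightarrow> nat) \<Rightarrow> real.
     p = (\<Sum>\<sigma> | \<sigma> permutes {1..m}. Poly_Mapping.single (map \<sigma> [1..<Suc m]) (c \<sigma>)))"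

text \<open>
  Real algebras are given as \<open>module\<close> records. The locale \<open>algebra\<close> of the library
  cannot be used for them, since it requires commutativity.
\<close>

definition word_eval :: "(real, 'a) module \<Rightarrow> (nat \<Rightarrow> 'a) \<Rightarrow> nat list \<Rightarrow> 'a" where
  "word_eval R a w = foldr (\<lambda>i y. a i \<otimes>\<^bsub>R\<^esub> y) w \<one>\<^bsub>R\<^esub>"

definition poly_eval :: "(real, 'a) module \<Rightarrow> free_alg \<Rightarrow> (nat \<Rightarrow> 'a) \<Rightarrow> 'a" where
  "poly_eval R p a =
     (\<Oplus>\<^bsub>R\<^esub>w\<in>Poly_Mapping.keys p. Poly_Mapping.lookup p w \<odot>\<^bsub>R\<^esub> word_eval R a w)"

text \<open>
  All variables are assigned elements of the carrier; those which do not occur in \<open>p\<close>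
  have no influence on the value.
\<close>

definition poly_image :: "free_alg \<Rightarrow> (real, 'a) module \<Rightarrow> 'a set" where
  "poly_image p R = {poly_eval R p a | a. \<forall>i. a i \<in> carrier R}"

section \<open>The algebras of quaternions and of quaternionic matrices\<close>

definition quat_alg :: "(real, quat) module" where
  "quat_alg = \<lparr>carrier = UNIV, monoid.mult = (*), one = 1, zero = 0, add = (+), smult = (*\<^sub>R)\<rparr>"

definition mat_alg :: "nat \<Rightarrow> (real, quat mat) module" where
  "mat_alg n = ring_mat TYPE(quat) n \<lparr>smult = \<lambda>r. map_mat ((*\<^sub>R) r)\<rparr>"

lemma ring_quat_alg: "ring quat_alg"
proof (rule ringI)
  have "\<exists>y. y + x = 0" for x :: quat
    by (rule exI[of _ "- x"]) simp
  then show "abelian_group quat_alg"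
    by (intro abelian_groupI) (simp_all add: quat_alg_def add_ac)
  show "monoid quat_alg"
    by (rule monoidI) (simp_all add: quat_alg_def mult.assoc)
qed (simp_all add: quat_alg_def distrib_left distrib_right)

text \<open>The library proves the following for matrices over commutative rings only.\<close>

lemma ring_mat_alg: "ring (mat_alg n)"
proof -
  interpret semiring "mat_alg n"
    unfolding mat_alg_def by (rule semiring_mat)
  show ?thesis
  proof (rule ringI)
    have "\<exists>B\<in>carrier_mat n n. B + A = 0\<^sub>m n n"
      if "A \<in> carrier_mat n n" for A :: "quat mat"
      using that by (intro bexI[of _ "- A"]) auto
    then have "\<exists>B\<in>carrier (mat_alg n). B \<oplus>\<^bsub>mat_alg n\<^esub> A = \<zero>\<^bsub>mat_alg n\<^esub>"
      if "A \<in> carrier (mat_alg n)" for A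
      using that by (simp add: mat_alg_def ring_mat_simps)
    then show "abelian_group (mat_alg n)"
      by (intro abelian_groupI) (simp_all add: a_ac)
    show "monoid (mat_alg n)" ..
  qed (simp_all add: l_distr r_distr)
qed

definition GL :: "nat \<Rightarrow> quat mat monoid" where
  "GL n = units_of (mat_alg n)"

definition SL :: "nat \<Rightarrow> quat mat set" where
  "SL n = derived (GL n) (carrier (GL n))"

end

theory Submission
  imports Defs "Jordan_Normal_Form.Determinant"
begin

text \<open>
  A multilinear polynomial whose image on the quaternions is neither \<open>{0}\<close> nor
  \<open>\<real>\<close> takes every nonzero pure quaternion as a value: evaluate it on basis quaternions,
  then use conjugation and scaling. On matrices it therefore takes all values that are similar to
  diagonal matrices with nonzero pure entries. Every unit quaternion is a commutator of pure ones,
  so any matrix similar to a diagonal one with unit entries is a commutator of such values.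

  It remains to write a matrix of Dieudonne determinant one as a product of two matrices that are
  similar to unit diagonal ones. After a similarity the matrix has pivot one, and
  it is split as a lower times an upper block triangular matrix, recursively on the Schur
  complement; the diagonal entries are chosen with distinct real parts, which makes both factors
  diagonalizable. The determinant controls the last entry, and it also takes care of the
  case in which a Schur complement is a real scalar, since this scalar then is \<open>1\<close> or \<open>- 1\<close>.

  For the second part, an arbitrary matrix is a difference of a lower and an upper triangular
  matrix of determinant one.
\<close>

section \<open>Unit and pure quaternions\<close>

definition qcnj :: "quat \<Rightarrow> quat" where
  "qcnj x = Quat (qre x) (- qi x) (- qj x) (- qk x)"

definition qnorm2 :: "quat \<Rightarrow> real" where
  "qnorm2 x = (qre x)\<^sup>2 + (qi x)\<^sup>2 + (qj x)\<^sup>2 + (qk x)\<^sup>2"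

lemma quat_sel [simp]:
  "qre 0 = 0" "qi 0 = 0" "qj 0 = 0" "qk 0 = 0"
  "qre 1 = 1" "qi 1 = 0" "qj 1 = 0" "qk 1 = 0"
  "qre (x + y) = qre x + qre y" "qi (x + y) = qi x + qi y"
  "qj (x + y) = qj x + qj y" "qk (x + y) = qk x + qk y"
  "qre (x - y) = qre x - qre y" "qi (x - y) = qi x - qi y"
  "qj (x - y) = qj x - qj y" "qk (x - y) = qk x - qk y"
  "qre (- x) = - qre x" "qi (- x) = - qi x" "qj (- x) = - qj x" "qk (- x) = - qk x"
  "qre (r *\<^sub>R x) = r * qre x" "qi (r *\<^sub>R x) = r * qi x"
  "qj (r *\<^sub>R x) = r * qj x" "qk (r *\<^sub>R x) = r * qk x"
  "qre (qcnj x) = qre x" "qi (qcnj x) = - qi x" "qj (qcnj x) = - qj x" "qk (qcnj x) = - qk x"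
  by (simp_all add: quat_ops qcnj_def)

lemma quat_sel_mult:
  "qre (x * y) = qre x * qre y - qi x * qi y - qj x * qj y - qk x * qk y"
  "qi (x * y) = qre x * qi y + qi x * qre y + qj x * qk y - qk x * qj y"
  "qj (x * y) = qre x * qj y - qi x * qk y + qj x * qre y + qk x * qi y"
  "qk (x * y) = qre x * qk y + qi x * qj y - qj x * qi y + qk x * qre y"
  by (simp_all add: quat_ops)

lemma quat_of_real: "of_real r = Quat r 0 0 0"
  by (simp add: of_real_def quat_eq_iff)

lemma quat_Reals_iff: "x \<in> \<real> \<longleftrightarrow> qi x = 0 \<and> qj x = 0 \<and> qk x = 0"
proof
  assume "qi x = 0 \<and> qj x = 0 \<and> qk x = 0"
  then have "x = of_real (qre x)"
    by (simp add: quat_of_real quat_eq_iff)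
  then show "x \<in> \<real>"
    by (metis Reals_of_real)
qed (auto simp: Reals_def quat_of_real)

lemma quat_of_real_commute: "of_real r * (x :: quat) = x * of_real r"
  by (simp add: quat_eq_iff quat_sel_mult quat_of_real)

text \<open>Commuting with \<open>Quat 0 1 0 0\<close> kills the last two coordinates, and commuting
  with \<open>Quat 0 0 1 0\<close> kills the remaining imaginary one.\<close>

lemma quat_central_iff: "(\<forall>h. a * h = h * a) \<longleftrightarrow> a \<in> (\<real> :: quat set)"
proof
  assume *: "\<forall>h. a * h = h * a"
  have "a * Quat 0 1 0 0 = Quat 0 1 0 0 * a" "a * Quat 0 0 1 0 = Quat 0 0 1 0 * a"
    using * by blast+
  then show "a \<in> \<real>"
    by (simp add: quat_Reals_iff quat_eq_iff quat_sel_mult)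
qed (auto simp: Reals_def quat_of_real_commute)

lemma qnorm2_simps [simp]: "qnorm2 0 = 0" "qnorm2 1 = 1"
  by (simp_all add: qnorm2_def)

lemma qnorm2_nonneg: "qnorm2 x \<ge> 0"
  by (simp add: qnorm2_def)

lemma qnorm2_eq_0_iff [simp]: "qnorm2 x = 0 \<longleftrightarrow> x = 0"
  by (auto simp: qnorm2_def quat_eq_iff add_nonneg_eq_0_iff)

lemma qnorm2_of_real: "qnorm2 (of_real r) = r\<^sup>2"
  by (simp add: qnorm2_def quat_of_real)

lemma qcnj_mult_self: "qcnj x * x = of_real (qnorm2 x)" "x * qcnj x = of_real (qnorm2 x)"
  by (simp_all add: quat_eq_iff quat_sel_mult quat_of_real qnorm2_def power2_eq_square)

lemma qcnj_add_self: "x + qcnj x = of_real (2 * qre x)"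
  by (simp add: quat_eq_iff quat_of_real)

text \<open>For units, \<open>a + qcnj a\<close> and \<open>d + qcnj d\<close> are real, so for
  \<open>y = w - qcnj d * w * qcnj a\<close> the difference \<open>d * y - y * a\<close> is a real multiple of \<open>w\<close>.\<close>

lemma unit_sylvester:
  assumes "qnorm2 a = 1" "qnorm2 d = 1" "qre a \<noteq> qre d"
  shows "\<exists>x. d * x - x * a = w"
proof
  define c where "c = 1 / (2 * (qre d - qre a))"
  let ?y = "w - qcnj d * w * qcnj a"
  have "d * ?y - ?y * a = d * w + qcnj d * w * (qcnj a * a) - (d * qcnj d) * w * qcnj a - w * a"
    by (simp add: algebra_simps)
  also have "\<dots> = (d + qcnj d) * w - w * (a + qcnj a)"
    using assms by (simp add: qcnj_mult_self algebra_simps)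
  also have "\<dots> = (2 * (qre d - qre a)) *\<^sub>R w"
    unfolding qcnj_add_self quat_of_real_commute[symmetric] by (simp add: scaleR_conv_of_real algebra_simps)
  finally have "c *\<^sub>R (d * ?y - ?y * a) = w"
    using assms by (simp add: c_def)
  then show "d * (c *\<^sub>R ?y) - (c *\<^sub>R ?y) * a = w"
    by (simp only: mult_scaleR_left mult_scaleR_right scaleR_right_diff_distrib[of c "d * ?y" "?y * a"])
qed

text \<open>Rescaling \<open>d\<close> to an \<open>e\<close> with the norm of \<open>q\<close>
  makes \<open>e\<close> and \<open>q\<close> square to the same real \<open>- N\<close>. Then
  \<open>h = N - e * q\<close> satisfies \<open>e * h = N * (e + q) = h * q\<close>, and it is
  nonzero unless \<open>e = - q\<close>; in that case \<open>h = 1\<close> works and the sign goes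
  into \<open>r\<close>.\<close>

lemma pure_quat_conj:
  assumes "qre q = 0" "q \<noteq> 0" "qre d = 0" "d \<noteq> 0"
  shows "\<exists>r h. r \<noteq> 0 \<and> h \<noteq> 0 \<and> d = r *\<^sub>R (h * q * inverse h)"
proof -
  have sq: "x * x = - of_real (qnorm2 x)" if "qre x = 0" for x
    using that by (simp add: quat_eq_iff quat_sel_mult quat_of_real qnorm2_def power2_eq_square)
  define s where "s = sqrt (qnorm2 d / qnorm2 q)"
  have pos: "qnorm2 q > 0" "qnorm2 d > 0"
    using assms qnorm2_nonneg[of q] qnorm2_nonneg[of d] qnorm2_eq_0_iff by (metis order_le_less)+
  then have s: "s > 0" "s\<^sup>2 = qnorm2 d / qnorm2 q"
    by (simp_all add: s_def)
  define e where "e = (1/s) *\<^sub>R d"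
  have e: "d = s *\<^sub>R e" "qre e = 0"
    using s assms by (simp_all add: e_def)
  have "e * e = ((1/s) * (1/s)) *\<^sub>R (d * d)"
    by (simp add: e_def)
  also have "\<dots> = - of_real ((1/s) * (1/s) * qnorm2 d)"
    unfolding sq[OF assms(3)] of_real_mult scaleR_conv_of_real by simp
  also have "(1/s) * (1/s) * qnorm2 d = qnorm2 q"
  proof -
    have "qnorm2 d = s\<^sup>2 * qnorm2 q"
      using s pos by auto
    then show ?thesis
      using s by (simp add: power2_eq_square)
  qed
  finally have ee: "e * e = - of_real (qnorm2 q)" .
  show ?thesis
  proof (cases "e = - q")
    case True
    then have "d = (-s) *\<^sub>R (1 * q * inverse 1)"
      by (simp add: e)
    then show ?thesis
      using s by (metis neg_0_equal_iff_equal order_less_irrefl one_neq_zero)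
  next
    case False
    define h where "h = of_real (qnorm2 q) - e * q"
    have "e * h = of_real (qnorm2 q) * e - (e * e) * q"
      by (simp add: h_def algebra_simps quat_of_real_commute)
    also have "\<dots> = of_real (qnorm2 q) * (e + q)"
      unfolding ee by (simp add: algebra_simps)
    finally have eh: "e * h = of_real (qnorm2 q) * (e + q)" .
    have "h * q = of_real (qnorm2 q) * q - e * (q * q)"
      by (simp add: h_def algebra_simps)
    also have "\<dots> = of_real (qnorm2 q) * (e + q)"
      using assms by (simp add: sq algebra_simps quat_of_real_commute)
    finally have "h * q = e * h"
      using eh by simp
    moreover have "h \<noteq> 0"
    proof
      assume "h = 0"
      then have "of_real (qnorm2 q) * (e + q) = 0"
        using eh by simp
      then show False
        using False pos by (simp add: add_eq_0_iff2)
    qed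
    ultimately have "d = s *\<^sub>R (h * q * inverse h)"
      by (simp add: e mult.assoc)
    then show ?thesis
      using s \<open>h \<noteq> 0\<close> by (metis order_less_irrefl)
  qed
qed

text \<open>If \<open>a\<close> is pure and orthogonal to \<open>q\<close>, then \<open>a * q = qcnj q * a\<close>, whence
  \<open>b = (1 + q) * a\<close> works unless \<open>q = - 1\<close>.\<close>

lemma unit_quat_commutator:
  assumes "qnorm2 q = 1"
  shows "\<exists>a b. a \<noteq> 0 \<and> b \<noteq> 0 \<and> qre a = 0 \<and> qre b = 0 \<and> q = b * a * inverse b * inverse a"
proof (cases "q = -1")
  case True
  \<comment> \<open>These two anticommute, so their commutator is \<open>- 1\<close>.\<close>
  have "Quat 0 1 0 0 * Quat 0 0 1 0 * inverse (Quat 0 1 0 0) * inverse (Quat 0 0 1 0) = q"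
    by (simp add: True inverse_quat_def quat_eq_iff quat_sel_mult)
  moreover have "Quat 0 1 0 0 \<noteq> 0" "Quat 0 0 1 0 \<noteq> 0"
    by (simp_all add: quat_eq_iff)
  ultimately show ?thesis
    by (metis quat.sel(1))
next
  case False
  \<comment> \<open>Orthogonality to the imaginary part of \<open>q\<close> is achieved by turning
    its first two coordinates by a right angle, unless both vanish.\<close>
  obtain a where a: "a \<noteq> 0" "qre a = 0" "qi a * qi q + qj a * qj q + qk a * qk q = 0"
  proof (cases "qi q = 0 \<and> qj q = 0")
    case True
    then show ?thesis
      by (intro that[of "Quat 0 1 0 0"]) (simp_all add: quat_eq_iff)
  next
    case False
    then show ?thesis
      by (intro that[of "Quat 0 (qj q) (- qi q) 0"]) (auto simp: quat_eq_iff)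
  qed
  define b where "b = (1 + q) * a"
  have q1: "1 + q \<noteq> 0"
    using False by (metis add_eq_0_iff)
  have b0: "b \<noteq> 0"
    using a q1 by (simp add: b_def)
  have "qre b = 0"
    using a by (simp add: b_def quat_sel_mult algebra_simps)
  have "q * (a * b) = b * a"
  proof -
    have "qcnj q * a = a * q"
      using a by (simp add: quat_eq_iff quat_sel_mult algebra_simps)
    then have "a * (1 + q) = (1 + qcnj q) * a"
      by (simp add: algebra_simps)
    then have "q * (a * b) = q * (1 + qcnj q) * a * a"
      by (simp add: b_def mult.assoc[symmetric])
    also have "q * (1 + qcnj q) = 1 + q"
      using assms by (simp add: distrib_left qcnj_mult_self add.commute)
    finally show ?thesis
      by (simp add: b_def)
  qed
  then have "b * a * inverse b * inverse a = q * (a * b) * inverse b * inverse a"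
    by simp
  also have "\<dots> = q * (a * (b * inverse b) * inverse a)"
    by (simp add: mult.assoc)
  also have "\<dots> = q"
    using a b0 by simp
  finally show ?thesis
    using a b0 \<open>qre b = 0\<close> by metis
qed

text \<open>An injective function meets a finite set at finitely many points only, so two of them
  cannot exhaust \<open>S\<close>. It is applied to angles.\<close>

lemma infinite_avoid:
  assumes "infinite S" "finite F" "inj_on f S" "inj_on g S"
  shows "\<exists>t\<in>S. f t \<notin> F \<and> g t \<notin> F"
proof (rule ccontr)
  assume "\<not> ?thesis"
  then have "S \<subseteq> (f -` F \<inter> S) \<union> (g -` F \<inter> S)"
    by auto
  moreover have "finite ((f -` F \<inter> S) \<union> (g -` F \<inter> S))"
    using assms by (simp add: finite_vimage_IntI)
  ultimately show False
    using assms(1) finite_subset by blast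
qed

lemma inj_on_cos: "inj_on cos {0..pi}"
  using cos_inj_pi by (simp add: inj_on_def)

text \<open>With \<open>q = cos p + sin p * u\<close> for a pure unit \<open>u\<close>, the elements
  \<open>e t = cos t + sin t * u\<close> satisfy the addition law of angles, so
  \<open>q = e t * e (p - t)\<close> for every \<open>t\<close>. Only finitely many angles in a
  suitable interval give a real part in \<open>F\<close>.\<close>

lemma unit_quat_factor:
  assumes "qnorm2 q = 1" "finite F"
  shows "\<exists>b c. qnorm2 b = 1 \<and> qnorm2 c = 1 \<and> q = b * c \<and> qre b \<notin> F \<and> qre c \<notin> F"
proof -
  define s where "s = sqrt ((qi q)\<^sup>2 + (qj q)\<^sup>2 + (qk q)\<^sup>2)"
  have s2: "s\<^sup>2 = (qi q)\<^sup>2 + (qj q)\<^sup>2 + (qk q)\<^sup>2" "s \<ge> 0"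
    by (simp_all add: s_def)
  have "(qre q)\<^sup>2 + s\<^sup>2 = 1"
    using assms(1) unfolding s2 by (simp add: qnorm2_def)
  then obtain p where p: "0 \<le> p" "p \<le> pi" "qre q = cos p" "s = sin p"
    using sincos_total_pi[OF s2(2)] by blast
  obtain u where u: "qre u = 0" "qnorm2 u = 1" "q = of_real (cos p) + of_real (sin p) * u"
  proof (cases "s = 0")
    case True
    then have "qi q = 0" "qj q = 0" "qk q = 0"
      using s2 by (auto simp: add_nonneg_eq_0_iff)
    \<comment> \<open>Here \<open>q\<close> is real and \<open>sin p = 0\<close>, so any pure unit
      serves as \<open>u\<close>.\<close>
    then show ?thesis
      using p True by (intro that[of "Quat 0 1 0 0"]) (simp_all add: qnorm2_def quat_eq_iff quat_of_real quat_sel_mult)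
  next
    case False
    have "qnorm2 (Quat 0 (qi q / s) (qj q / s) (qk q / s)) = ((qi q)\<^sup>2 + (qj q)\<^sup>2 + (qk q)\<^sup>2) / s\<^sup>2"
      by (simp add: qnorm2_def power_divide add_divide_distrib)
    also have "\<dots> = 1"
      unfolding s2(1)[symmetric] using False by simp
    finally show ?thesis
      using False
      by (intro that[of "Quat 0 (qi q / s) (qj q / s) (qk q / s)"])
         (simp_all add: quat_eq_iff quat_sel_mult quat_of_real p(3) p(4)[symmetric])
  qed
  define e where "e t = of_real (cos t) + of_real (sin t) * u" for t
  have uu: "u * u = -1"
    using u by (simp add: quat_eq_iff quat_sel_mult qnorm2_def power2_eq_square)
  have re: "qre (e t) = cos t" for t
    using u by (simp add: e_def quat_sel_mult quat_of_real)
  have norm: "qnorm2 (e t) = 1" for t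
  proof -
    have "qnorm2 (e t) = (cos t)\<^sup>2 + (sin t)\<^sup>2 * qnorm2 u"
      using u(1) by (simp add: e_def qnorm2_def quat_sel_mult quat_of_real power_mult_distrib algebra_simps)
    then show ?thesis
      using u by simp
  qed
  have "e t * e t' = e (t + t')" for t t'
  proof -
    have "e t * e t' = of_real (cos t * cos t') + of_real (sin t * sin t') * (u * u)
        + of_real (sin t * cos t' + cos t * sin t') * u"
      by (simp add: e_def quat_eq_iff quat_sel_mult quat_of_real algebra_simps)
    then show ?thesis
      by (simp add: uu e_def cos_add sin_add algebra_simps)
  qed
  then have q: "q = e t * e (p - t)" for t
    using u by (simp add: e_def)
  \<comment> \<open>On \<open>{p..pi}\<close> both \<open>t\<close> and \<open>t - p\<close> stay in
    \<open>{0..pi}\<close>, where \<open>cos\<close> is injective. For \<open>p = pi\<close> this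
    interval is a single point; \<open>{0..pi}\<close> replaces it, since
    \<open>cos (pi - t) = - cos t\<close>.\<close>
  have "\<exists>t. cos t \<notin> F \<and> cos (p - t) \<notin> F"
  proof (cases "p < pi")
    case True
    have "inj_on cos {p..pi}"
      using p by (intro inj_on_subset[OF inj_on_cos]) auto
    moreover have "inj_on (\<lambda>t. cos (p - t)) {p..pi}"
    proof (rule inj_onI)
      fix x y assume xy: "x \<in> {p..pi}" "y \<in> {p..pi}" "cos (p - x) = cos (p - y)"
      have "cos (x - p) = cos (y - p)"
        using xy(3) cos_minus[of "p - x"] cos_minus[of "p - y"] by simp
      then have "x - p = y - p"
        by (rule inj_onD[OF inj_on_cos]) (use xy p in auto)
      then show "x = y"
        by simp
    qed
    ultimately show ?thesis
      using infinite_avoid[OF infinite_Icc[OF True] assms(2)] by blast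
  next
    case False
    then have p: "p = pi"
      using p by simp
    have "inj_on cos {0..pi}"
      by (rule inj_on_cos)
    moreover have "inj_on (\<lambda>t. cos (p - t)) {0..pi}"
      by (rule inj_onI) (use cos_inj_pi in \<open>simp add: p cos_diff\<close>)
    ultimately show ?thesis
      using infinite_avoid[OF infinite_Icc[OF pi_gt_zero] assms(2)] by blast
  qed
  then obtain t where "cos t \<notin> F" "cos (p - t) \<notin> F"
    by blast
  then have "qnorm2 (e t) = 1 \<and> qnorm2 (e (p - t)) = 1 \<and> q = e t * e (p - t)
      \<and> qre (e t) \<notin> F \<and> qre (e (p - t)) \<notin> F"
    unfolding re by (intro conjI norm q)
  then show ?thesis
    by blast
qed

section \<open>The Dieudonne determinant\<close>

text \<open>For \<open>x = z + w j\<close> with complex \<open>z\<close> and \<open>w\<close>, the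
  rows of the image are \<open>z, w\<close> and \<open>- cnj w, cnj z\<close>.\<close>

definition qblock :: "quat \<Rightarrow> nat \<Rightarrow> nat \<Rightarrow> complex" where
  "qblock x i j =
     (if i = 0 then if j = 0 then Complex (qre x) (qi x) else Complex (qj x) (qk x)
      else if j = 0 then Complex (- qj x) (qk x) else Complex (qre x) (- qi x))"

text \<open>The standard embedding of quaternions into complex \<open>2 \<times> 2\<close> matrices, applied
  entrywise without reordering rows or columns, so that block decompositions are preserved.\<close>

definition cmat :: "quat mat \<Rightarrow> complex mat" where
  "cmat A = mat (2 * dim_row A) (2 * dim_col A)
     (\<lambda>(i, j). qblock (A $$ (i div 2, j div 2)) (i mod 2) (j mod 2))"

text \<open>This is the Study determinant. On invertible matrices it is the square of the Dieudonne
  determinant, when the latter takes the norm as its value on a single quaternion.\<close>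

definition ddet :: "quat mat \<Rightarrow> complex" where
  "ddet A = det (cmat A)"

lemma cmat_carrier [simp]: "A \<in> carrier_mat n m \<Longrightarrow> cmat A \<in> carrier_mat (2 * n) (2 * m)"
  by (auto simp: cmat_def)

lemma qblock_add: "qblock (x + y) i j = qblock x i j + qblock y i j"
  by (auto simp: qblock_def complex_eq_iff)

lemma qblock_0: "qblock 0 i j = 0"
  by (auto simp: qblock_def complex_eq_iff)

lemma qblock_sum: "qblock (sum f S) i j = (\<Sum>k\<in>S. qblock (f k) i j)"
  by (induction S rule: infinite_finite_induct) (simp_all add: qblock_0 qblock_add)

lemma qblock_mult:
  "i < 2 \<Longrightarrow> j < 2 \<Longrightarrow> qblock (x * y) i j = qblock x i 0 * qblock y 0 j + qblock x i 1 * qblock y 1 j"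
  by (auto simp: qblock_def complex_eq_iff quat_sel_mult algebra_simps)

lemma sum_double: "(\<Sum>k<2 * n. f k) = (\<Sum>k<n. f (2 * k) + f (2 * k + 1))"
  for f :: "nat \<Rightarrow> 'a :: comm_monoid_add"
  by (induction n) (simp_all add: add.assoc)

text \<open>The inner sum over \<open>2 * m\<close> indices is grouped into \<open>m\<close> pairs
  by \<open>sum_double\<close>, and each pair is an entry of a product of two by two blocks.\<close>

lemma cmat_mult:
  assumes "A \<in> carrier_mat n m" "B \<in> carrier_mat m k"
  shows "cmat (A * B) = cmat A * cmat B"
proof (rule eq_matI)
  fix i j assume "i < dim_row (cmat A * cmat B)" "j < dim_col (cmat A * cmat B)"
  then have i: "i < 2 * n" and j: "j < 2 * k"
    using assms by (auto simp: cmat_def)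
  then have ij: "i div 2 < n" "j div 2 < k"
    by auto
  have "cmat (A * B) $$ (i, j) = qblock (\<Sum>l<m. A $$ (i div 2, l) * B $$ (l, j div 2)) (i mod 2) (j mod 2)"
    using i j ij assms by (auto simp: cmat_def scalar_prod_def lessThan_atLeast0)
  also have "\<dots> = (\<Sum>l<m. qblock (A $$ (i div 2, l)) (i mod 2) 0 * qblock (B $$ (l, j div 2)) 0 (j mod 2)
      + qblock (A $$ (i div 2, l)) (i mod 2) 1 * qblock (B $$ (l, j div 2)) 1 (j mod 2))"
    by (simp add: qblock_sum qblock_mult)
  also have "\<dots> = (\<Sum>l<2 * m. qblock (A $$ (i div 2, l div 2)) (i mod 2) (l mod 2)
      * qblock (B $$ (l div 2, j div 2)) (l mod 2) (j mod 2))"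
    by (simp add: sum_double)
  also have "\<dots> = (cmat A * cmat B) $$ (i, j)"
    using i j assms by (auto simp: cmat_def scalar_prod_def lessThan_atLeast0 intro!: sum.cong)
  finally show "cmat (A * B) $$ (i, j) = (cmat A * cmat B) $$ (i, j)" .
qed (use assms in \<open>auto simp: cmat_def\<close>)

lemma cmat_zero: "cmat (0\<^sub>m n m) = 0\<^sub>m (2 * n) (2 * m)"
  by (rule eq_matI) (auto simp: cmat_def qblock_0 less_mult_imp_div_less mult.commute)

lemma cmat_one: "cmat (1\<^sub>m n) = 1\<^sub>m (2 * n)"
proof (rule eq_matI)
  fix i j assume "i < dim_row (1\<^sub>m (2 * n) :: complex mat)" "j < dim_col (1\<^sub>m (2 * n) :: complex mat)"
  then have "i < 2 * n" "j < 2 * n" "i div 2 < n" "j div 2 < n"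
    by auto
  moreover have "i = j \<longleftrightarrow> i div 2 = j div 2 \<and> i mod 2 = j mod 2"
    by (metis div_mult_mod_eq)
  ultimately show "cmat (1\<^sub>m n) $$ (i, j) = 1\<^sub>m (2 * n) $$ (i, j)"
    by (auto simp: cmat_def qblock_def complex_eq_iff)
qed (auto simp: cmat_def)

text \<open>The border between the blocks moves to the even position \<open>2 * n\<close>, so
  halving an index never crosses it.\<close>

lemma cmat_four_block:
  assumes "A \<in> carrier_mat n n" "B \<in> carrier_mat n m" "C \<in> carrier_mat m n" "D \<in> carrier_mat m m"
  shows "cmat (four_block_mat A B C D) = four_block_mat (cmat A) (cmat B) (cmat C) (cmat D)"
proof (rule eq_matI)
  fix i j assume "i < dim_row (four_block_mat (cmat A) (cmat B) (cmat C) (cmat D))"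
    "j < dim_col (four_block_mat (cmat A) (cmat B) (cmat C) (cmat D))"
  then have ij: "i < 2 * (n + m)" "j < 2 * (n + m)"
    using assms by (auto simp: cmat_def)
  have k: "k div 2 < n + m" "k - 2 * n < 2 * m" if "\<not> k < 2 * n" "k < 2 * (n + m)" for k
    using that by auto
  have d: "k div 2 < n \<longleftrightarrow> k < 2 * n" "(k - 2 * n) div 2 = k div 2 - n" for k
    by auto
  have m: "(k - 2 * n) mod 2 = k mod 2" if "\<not> k < 2 * n" for k
    using that by (metis le_add_diff_inverse mod_mult_self4 not_less)
  have dims: "dim_row A = n" "dim_col A = n" "dim_row B = n" "dim_col B = m"
    "dim_row C = m" "dim_col C = n" "dim_row D = m" "dim_col D = m"
    using assms by auto
  show "cmat (four_block_mat A B C D) $$ (i, j) =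
      four_block_mat (cmat A) (cmat B) (cmat C) (cmat D) $$ (i, j)"
    using ij by (cases "i < 2 * n"; cases "j < 2 * n")
      (simp_all add: cmat_def dims d m k)
qed (use assms in \<open>auto simp: cmat_def\<close>)

lemma ddet_mult: "A \<in> carrier_mat n n \<Longrightarrow> B \<in> carrier_mat n n \<Longrightarrow> ddet (A * B) = ddet A * ddet B"
  by (simp add: ddet_def cmat_mult det_mult[of _ "2 * n"])

lemma ddet_one [simp]: "ddet (1\<^sub>m n) = 1"
  by (simp add: ddet_def cmat_one)

lemma ddet_lower_block:
  assumes "A \<in> carrier_mat n n" "C \<in> carrier_mat m n" "D \<in> carrier_mat m m"
  shows "ddet (four_block_mat A (0\<^sub>m n m) C D) = ddet A * ddet D"
  unfolding ddet_def
  by (subst cmat_four_block[OF assms(1) _ assms(2,3)], simp, unfold cmat_zero,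
      rule det_four_block_mat_upper_right_zero[of _ "2 * n" _ "2 * m"]) (use assms in auto)

lemma ddet_upper_block:
  assumes "A \<in> carrier_mat n n" "B \<in> carrier_mat n m" "D \<in> carrier_mat m m"
  shows "ddet (four_block_mat A B (0\<^sub>m m n) D) = ddet A * ddet D"
  unfolding ddet_def
  by (subst cmat_four_block[OF assms(1,2) _ assms(3)], simp, unfold cmat_zero,
      rule det_four_block_mat_lower_left_zero[of _ "2 * n" _ "2 * m"]) (use assms in auto)

text \<open>The image is read as a block matrix with commuting one by one blocks; its determinant is
  \<open>z * cnj z + w * cnj w\<close>.\<close>

lemma ddet_scalar:
  assumes "A \<in> carrier_mat 1 1"
  shows "ddet A = of_real (qnorm2 (A $$ (0, 0)))"
proof -
  let ?m = "\<lambda>i j. mat 1 1 (\<lambda>_. qblock (A $$ (0, 0)) i j)"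
  have "cmat A = four_block_mat (?m 0 0) (?m 0 1) (?m 1 0) (?m 1 1)"
    using assms by (intro eq_matI) (auto simp: cmat_def less_Suc_eq)
  then have "ddet A = det (?m 0 0 * ?m 1 1 - ?m 0 1 * ?m 1 0)"
    unfolding ddet_def by (simp only:, intro det_four_block_mat[of _ 1])
      (auto simp: scalar_prod_def mult.commute)
  also have "\<dots> = (?m 0 0 * ?m 1 1 - ?m 0 1 * ?m 1 0) $$ (0, 0)"
    by (intro det_single) auto
  finally show ?thesis
    by (simp add: scalar_prod_def qblock_def complex_eq_iff qnorm2_def power2_eq_square)
qed

lemma ddet_similar:
  assumes "similar_mat A B"
  shows "ddet A = ddet B"
proof -
  obtain n P Q where PQ: "{A, B, P, Q} \<subseteq> carrier_mat n n" "P * Q = 1\<^sub>m n" "A = P * B * Q"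
    using similar_matD[OF assms] by blast
  then have "ddet P * ddet Q = 1"
    using ddet_mult[of P n Q] by simp
  moreover have "ddet A = ddet P * ddet B * ddet Q"
    using PQ ddet_mult[of "P * B" n Q] ddet_mult[of P n B] mult_carrier_mat[of P n n B n] by auto
  ultimately show ?thesis
    by (simp add: mult_ac)
qed

text \<open>The last row and column are split off, so the leading block keeps its indices in the
  induction.\<close>

lemma ddet_upper_triangular:
  assumes "A \<in> carrier_mat n n" "\<And>i j. j < i \<Longrightarrow> i < n \<Longrightarrow> A $$ (i, j) = 0"
  shows "ddet A = of_real (\<Prod>i<n. qnorm2 (A $$ (i, i)))"
  using assms
proof (induction n arbitrary: A)
  case 0
  then show ?case
    by (simp add: ddet_def cmat_def)
next
  case (Suc n)
  define B where "B = mat n n (\<lambda>(i, j). A $$ (i, j))"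
  have A: "A = four_block_mat B (mat n 1 (\<lambda>(i, j). A $$ (i, n))) (0\<^sub>m 1 n) (mat 1 1 (\<lambda>_. A $$ (n, n)))"
    using Suc.prems by (intro eq_matI) (auto simp: B_def less_Suc_eq)
  have "ddet A = ddet B * of_real (qnorm2 (A $$ (n, n)))"
    by (subst A, subst ddet_upper_block[of _ n _ 1]) (auto simp: B_def ddet_scalar)
  moreover have "ddet B = of_real (\<Prod>i<n. qnorm2 (A $$ (i, i)))"
    using Suc.prems by (subst Suc.IH) (auto simp: B_def)
  ultimately show ?case
    by simp
qed

lemma ddet_lower_triangular:
  assumes "A \<in> carrier_mat n n" "\<And>i j. i < j \<Longrightarrow> j < n \<Longrightarrow> A $$ (i, j) = 0"
  shows "ddet A = of_real (\<Prod>i<n. qnorm2 (A $$ (i, i)))"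
  using assms
proof (induction n arbitrary: A)
  case 0
  then show ?case
    by (simp add: ddet_def cmat_def)
next
  case (Suc n)
  define B where "B = mat n n (\<lambda>(i, j). A $$ (i, j))"
  have A: "A = four_block_mat B (0\<^sub>m n 1) (mat 1 n (\<lambda>(i, j). A $$ (n, j))) (mat 1 1 (\<lambda>_. A $$ (n, n)))"
    using Suc.prems by (intro eq_matI) (auto simp: B_def less_Suc_eq)
  have "ddet A = ddet B * of_real (qnorm2 (A $$ (n, n)))"
    by (subst A, subst ddet_lower_block[of _ n _ 1]) (auto simp: B_def ddet_scalar)
  moreover have "ddet B = of_real (\<Prod>i<n. qnorm2 (A $$ (i, i)))"
    using Suc.prems by (subst Suc.IH) (auto simp: B_def)
  ultimately show ?case
    by simp
qed

section \<open>Similarity of block triangular matrices\<close>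

text \<open>In this form a similarity needs one product on each side instead of the triple product
  \<open>P * B * Q\<close>.\<close>

lemma similar_mat_intertwine:
  assumes "A \<in> carrier_mat n n" "B \<in> carrier_mat n n" "P \<in> carrier_mat n n" "Q \<in> carrier_mat n n"
    and "P * Q = 1\<^sub>m n" "Q * P = 1\<^sub>m n" "Q * A = B * Q"
  shows "similar_mat A B"
proof -
  have "A = P * Q * A"
    unfolding assms(5) using assms(1) by simp
  also have "\<dots> = P * (Q * A)"
    using assms(1-4) by (intro assoc_mult_mat)
  also have "\<dots> = P * B * Q"
    using assms(1-4) unfolding assms(7) by (intro assoc_mult_mat[symmetric])
  finally show ?thesis
    using assms by (intro similar_matI[of A B P Q n]) auto
qed

lemma uminus_zero_mat [simp]: "- (0\<^sub>m n m :: 'a :: group_add mat) = 0\<^sub>m n m"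
  by (rule eq_matI) auto

text \<open>Conjugation by the unipotent block matrix with \<open>Z\<close> in the upper right
  corner. The three equations compare the blocks of the intertwining relation; the lower left block
  \<open>C\<close> survives.\<close>

lemma similar_upper_shear:
  fixes A :: "'a :: ring_1 mat"
  assumes c: "A \<in> carrier_mat n n" "B \<in> carrier_mat n m" "C \<in> carrier_mat m n" "D \<in> carrier_mat m m"
      "A' \<in> carrier_mat n n" "B' \<in> carrier_mat n m" "D' \<in> carrier_mat m m" "Z \<in> carrier_mat n m"
    and eq: "A' = A + Z * C" "A' * Z + B' = B + Z * D" "C * Z + D' = D"
  shows "similar_mat (four_block_mat A B C D) (four_block_mat A' B' C D')"
proof (rule similar_mat_intertwine[where n = "n + m"])
  let ?P = "four_block_mat (1\<^sub>m n) (- Z) (0\<^sub>m m n) (1\<^sub>m m)"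
  let ?Q = "four_block_mat (1\<^sub>m n) Z (0\<^sub>m m n) (1\<^sub>m m)"
  have [simp]: "Z + - Z = 0\<^sub>m n m" "- Z + Z = 0\<^sub>m n m"
    using c by auto
  show "?P * ?Q = 1\<^sub>m (n + m)" "?Q * ?P = 1\<^sub>m (n + m)"
    using c by (subst mult_four_block_mat[of _ n n _ m _ m _ _ n _ m]; simp add: four_block_one_mat)+
  have "?Q * four_block_mat A B C D = four_block_mat (A + Z * C) (B + Z * D) C D"
    using c by (subst mult_four_block_mat[of _ n n _ m _ m _ _ n _ m]) auto
  also have "\<dots> = four_block_mat A' B' C D' * ?Q"
    using c eq by (subst mult_four_block_mat[of _ n n _ m _ m _ _ n _ m]) auto
  finally show "?Q * four_block_mat A B C D = four_block_mat A' B' C D' * ?Q" .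
qed (use c in auto)

text \<open>The mirror image, with \<open>W\<close> in the lower left corner; now the upper right
  block \<open>B\<close> survives.\<close>

lemma similar_lower_shear:
  fixes A :: "'a :: ring_1 mat"
  assumes c: "A \<in> carrier_mat n n" "B \<in> carrier_mat n m" "C \<in> carrier_mat m n" "D \<in> carrier_mat m m"
      "A' \<in> carrier_mat n n" "C' \<in> carrier_mat m n" "D' \<in> carrier_mat m m" "W \<in> carrier_mat m n"
    and eq: "A' + B * W = A" "C' + D' * W = W * A + C" "D' = W * B + D"
  shows "similar_mat (four_block_mat A B C D) (four_block_mat A' B C' D')"
proof (rule similar_mat_intertwine[where n = "n + m"])
  let ?P = "four_block_mat (1\<^sub>m n) (0\<^sub>m n m) (- W) (1\<^sub>m m)"
  let ?Q = "four_block_mat (1\<^sub>m n) (0\<^sub>m n m) W (1\<^sub>m m)"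
  have [simp]: "W + - W = 0\<^sub>m m n" "- W + W = 0\<^sub>m m n"
    using c by auto
  show "?P * ?Q = 1\<^sub>m (n + m)" "?Q * ?P = 1\<^sub>m (n + m)"
    using c by (subst mult_four_block_mat[of _ n n _ m _ m _ _ n _ m]; simp add: four_block_one_mat)+
  have "?Q * four_block_mat A B C D = four_block_mat A B (W * A + C) (W * B + D)"
    using c by (subst mult_four_block_mat[of _ n n _ m _ m _ _ n _ m]) auto
  also have "\<dots> = four_block_mat A' B C' D' * ?Q"
    using c eq by (subst mult_four_block_mat[of _ n n _ m _ m _ _ n _ m]) auto
  finally show "?Q * four_block_mat A B C D = four_block_mat A' B C' D' * ?Q" .
qed (use c in auto)

section \<open>Diagonalizing block triangular matrices with a scalar corner\<close>

abbreviation mat1 :: "'a \<Rightarrow> 'a mat" where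
  "mat1 a \<equiv> mat 1 1 (\<lambda>_. a)"

lemma mat1_mult_index:
  fixes b :: "'a :: semiring_0"
  assumes "i < m"
  shows "Z \<in> carrier_mat 1 m \<Longrightarrow> (mat1 b * Z) $$ (0, i) = b * Z $$ (0, i)"
    and "W \<in> carrier_mat m 1 \<Longrightarrow> (W * mat1 b) $$ (i, 0) = W $$ (i, 0) * b"
  using assms by (auto simp: scalar_prod_def)

lemma mat_diag_mult_index:
  fixes f :: "nat \<Rightarrow> 'a :: semiring_0"
  assumes "i < m"
  shows "W \<in> carrier_mat m 1 \<Longrightarrow> (mat_diag m f * W) $$ (i, 0) = f i * W $$ (i, 0)"
    and "Z \<in> carrier_mat 1 m \<Longrightarrow> (Z * mat_diag m f) $$ (0, i) = Z $$ (0, i) * f i"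
  using assms by (simp_all add: mat_diag_mult_left[of _ m 1] mat_diag_mult_right[of _ 1 m])

lemma dim_mat_diag [simp]: "dim_row (mat_diag n f) = n" "dim_col (mat_diag n f) = n"
  by (simp_all add: mat_diag_def)

lemma mat_diag_case_nat:
  "mat_diag (Suc m) (case_nat b f) = four_block_mat (mat1 b) (0\<^sub>m 1 m) (0\<^sub>m m 1) (mat_diag m f)"
  by (rule eq_matI) (auto simp: mat_diag_def split: nat.split)

text \<open>Conjugation by a block diagonal matrix with blocks \<open>1\<close> and
  \<open>P\<close>, where \<open>P\<close> carries \<open>D'\<close> to \<open>D\<close>. It only
  changes \<open>C\<close> to \<open>Q * C\<close>.\<close>

lemma similar_four_block_lower:
  fixes D :: "'a :: semiring_1 mat"
  assumes "A \<in> carrier_mat n n" "C \<in> carrier_mat m n" "similar_mat D D'" "D \<in> carrier_mat m m"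
  shows "\<exists>C'\<in>carrier_mat m n. similar_mat (four_block_mat A (0\<^sub>m n m) C D) (four_block_mat A (0\<^sub>m n m) C' D')"
proof -
  obtain P Q where PQ: "similar_mat_wit D D' P Q"
    using assms by (auto simp: similar_mat_def)
  note w = similar_mat_witD2[OF assms(4) PQ]
  have "P * (Q * C) * 1\<^sub>m n = C"
    using w assms by (simp flip: assoc_mult_mat[of P m m Q m C n])
  then have "similar_mat_wit (four_block_mat A (0\<^sub>m n m) C D) (four_block_mat A (0\<^sub>m n m) (Q * C) D')
    (four_block_mat (1\<^sub>m n) (0\<^sub>m n m) (0\<^sub>m m n) P) (four_block_mat (1\<^sub>m n) (0\<^sub>m n m) (0\<^sub>m m n) Q)"
    using w assms by (intro similar_mat_wit_four_block[OF similar_mat_wit_refl PQ]) auto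
  then show ?thesis
    using w assms(2) by (auto simp: similar_mat_def intro!: bexI[of _ "Q * C"])
qed

lemma similar_four_block_upper:
  fixes D :: "'a :: semiring_1 mat"
  assumes "A \<in> carrier_mat n n" "B \<in> carrier_mat n m" "similar_mat D D'" "D \<in> carrier_mat m m"
  shows "\<exists>B'\<in>carrier_mat n m. similar_mat (four_block_mat A B (0\<^sub>m m n) D) (four_block_mat A B' (0\<^sub>m m n) D')"
proof -
  obtain P Q where PQ: "similar_mat_wit D D' P Q"
    using assms by (auto simp: similar_mat_def)
  note w = similar_mat_witD2[OF assms(4) PQ]
  have "1\<^sub>m n * (B * P) * Q = B"
    using w assms by (simp add: assoc_mult_mat[of B n m P m Q m])
  then have "similar_mat_wit (four_block_mat A B (0\<^sub>m m n) D) (four_block_mat A (B * P) (0\<^sub>m m n) D')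
    (four_block_mat (1\<^sub>m n) (0\<^sub>m n m) (0\<^sub>m m n) P) (four_block_mat (1\<^sub>m n) (0\<^sub>m n m) (0\<^sub>m m n) Q)"
    using w assms by (intro similar_mat_wit_four_block[OF similar_mat_wit_refl PQ]) auto
  then show ?thesis
    using w assms(2) by (auto simp: similar_mat_def intro!: bexI[of _ "B * P"])
qed

text \<open>Once \<open>D\<close> is diagonal, a lower shear removes the column below
  \<open>b\<close>. Its entries solve the separate equations
  \<open>f i * x - x * b = C' $$ (i, 0)\<close>, which \<open>unit_sylvester\<close> allows because
  the real parts differ.\<close>

lemma similar_diag_lower:
  assumes "C \<in> carrier_mat m 1" "D \<in> carrier_mat m m" "similar_mat D (mat_diag m f)" "qnorm2 b = 1"
    and f: "\<And>i. qnorm2 (f i) = 1" "\<And>i. qre (f i) \<noteq> qre b"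
  shows "similar_mat (four_block_mat (mat1 b) (0\<^sub>m 1 m) C D) (mat_diag (Suc m) (case_nat b f))"
proof -
  obtain C' where C': "C' \<in> carrier_mat m 1"
    and sim: "similar_mat (four_block_mat (mat1 b) (0\<^sub>m 1 m) C D) (four_block_mat (mat1 b) (0\<^sub>m 1 m) C' (mat_diag m f))"
    using similar_four_block_lower[OF _ assms(1,3,2), of "mat1 b"] by auto
  have "\<exists>x. f i * x - x * b = C' $$ (i, 0)" for i
    using unit_sylvester[of b "f i"] assms(4) f by metis
  then obtain w where w: "\<And>i. f i * w i - w i * b = C' $$ (i, 0)"
    by metis
  define W where "W = mat m 1 (\<lambda>(i, j). w i)"
  have W: "W \<in> carrier_mat m 1"
    by (simp add: W_def)
  have "mat_diag m f * W = W * mat1 b + C'"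
  proof (rule eq_matI)
    fix i j assume "i < dim_row (W * mat1 b + C')" "j < dim_col (W * mat1 b + C')"
    then have ij: "i < m" "j = 0"
      using C' by auto
    then show "(mat_diag m f * W) $$ (i, j) = (W * mat1 b + C') $$ (i, j)"
      using W C' w[of i, unfolded diff_eq_eq] by (simp add: add.commute mat_diag_mult_index mat1_mult_index W_def del: index_mult_mat(1) One_nat_def)
  qed (use W C' in auto)
  then have "similar_mat (four_block_mat (mat1 b) (0\<^sub>m 1 m) C' (mat_diag m f))
      (four_block_mat (mat1 b) (0\<^sub>m 1 m) (0\<^sub>m m 1) (mat_diag m f))"
    using W C' by (intro similar_lower_shear[where n = 1 and m = m and W = W]) auto
  then show ?thesis
    unfolding mat_diag_case_nat using sim similar_mat_trans by blast
qed

text \<open>As for the lower triangular case, with an upper shear and the equations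
  \<open>b * x - x * f i = B' $$ (0, i)\<close>.\<close>

lemma similar_diag_upper:
  assumes "B \<in> carrier_mat 1 m" "D \<in> carrier_mat m m" "similar_mat D (mat_diag m f)" "qnorm2 b = 1"
    and f: "\<And>i. qnorm2 (f i) = 1" "\<And>i. qre (f i) \<noteq> qre b"
  shows "similar_mat (four_block_mat (mat1 b) B (0\<^sub>m m 1) D) (mat_diag (Suc m) (case_nat b f))"
proof -
  obtain B' where B': "B' \<in> carrier_mat 1 m"
    and sim: "similar_mat (four_block_mat (mat1 b) B (0\<^sub>m m 1) D) (four_block_mat (mat1 b) B' (0\<^sub>m m 1) (mat_diag m f))"
    using similar_four_block_upper[OF _ assms(1,3,2), of "mat1 b"] by auto
  have "\<exists>x. b * x - x * f i = B' $$ (0, i)" for i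
    using unit_sylvester[of "f i" b] assms(4) f by metis
  then obtain z where z: "\<And>i. b * z i - z i * f i = B' $$ (0, i)"
    by metis
  define Z where "Z = mat 1 m (\<lambda>(i, j). z j)"
  have Z: "Z \<in> carrier_mat 1 m"
    by (simp add: Z_def)
  have "mat1 b * Z = B' + Z * mat_diag m f"
  proof (rule eq_matI)
    fix i j assume "i < dim_row (B' + Z * mat_diag m f)" "j < dim_col (B' + Z * mat_diag m f)"
    then have ij: "i = 0" "j < m"
      using B' Z by auto
    then show "(mat1 b * Z) $$ (i, j) = (B' + Z * mat_diag m f) $$ (i, j)"
      using Z B' z[of j, unfolded diff_eq_eq] by (simp add: mat_diag_mult_index mat1_mult_index Z_def del: index_mult_mat(1) One_nat_def)
  qed (use Z B' in auto)
  then have "similar_mat (four_block_mat (mat1 b) B' (0\<^sub>m m 1) (mat_diag m f))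
      (four_block_mat (mat1 b) (0\<^sub>m 1 m) (0\<^sub>m m 1) (mat_diag m f))"
    using Z B' by (intro similar_upper_shear[where n = 1 and m = m and Z = Z]) auto
  then show ?thesis
    unfolding mat_diag_case_nat using sim similar_mat_trans by blast
qed

section \<open>Factorization into diagonalizable matrices with unit eigenvalues\<close>

lemma mult_delta:
  fixes x y :: "'a :: mult_zero"
  shows "(if c then x else 0) * y = (if c then x * y else 0)"
    and "y * (if c then x else 0) = (if c then y * x else 0)"
  by simp_all

lemma mat1_mult [simp]: "mat1 a * mat1 b = mat1 (a * b :: 'a :: semiring_0)"
  by (rule eq_matI) (auto simp: scalar_prod_def)

lemma mat1_one: "mat1 (1 :: 'a :: semiring_1) = 1\<^sub>m 1"
  by (rule eq_matI) auto

lemma mat1_one_mult: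
  fixes Z :: "'a :: semiring_1 mat"
  assumes "Z \<in> carrier_mat 1 m"
  shows "mat1 1 * Z = Z"
  unfolding mat1_one using assms by simp

text \<open>An upper shear turns the corner into \<open>a + Z * C\<close>. A single nonzero entry of
  \<open>Z\<close>, placed opposite a nonzero entry of \<open>C\<close>, makes this
  \<open>1\<close>.\<close>

lemma pivot_one_column:
  fixes a :: "'a :: division_ring"
  assumes "B \<in> carrier_mat 1 m" "C \<in> carrier_mat m 1" "D \<in> carrier_mat m m" "k < m" "C $$ (k, 0) \<noteq> 0"
  shows "\<exists>B'\<in>carrier_mat 1 m. \<exists>D'\<in>carrier_mat m m.
    similar_mat (four_block_mat (mat1 a) B C D) (four_block_mat (mat1 1) B' C D')"
proof -
  define Z where "Z = mat 1 m (\<lambda>(i, j). if j = k then (1 - a) * inverse (C $$ (k, 0)) else 0)"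
  have Z: "Z \<in> carrier_mat 1 m"
    by (simp add: Z_def)
  have "(Z * C) $$ (0, 0) = 1 - a"
    using assms by (simp add: Z_def scalar_prod_def mult_delta mult.assoc)
  then have "mat1 1 = mat1 a + Z * C"
    using assms Z by (intro eq_matI) auto
  moreover have "mat1 1 * Z + (B + Z * D - Z) = B + Z * D" "C * Z + (D - C * Z) = D"
    unfolding mat1_one_mult[OF Z] using assms Z by (auto intro!: eq_matI simp del: index_mult_mat(1))
  ultimately have "similar_mat (four_block_mat (mat1 a) B C D) (four_block_mat (mat1 1) (B + Z * D - Z) C (D - C * Z))"
    using assms Z by (intro similar_upper_shear[where n = 1 and m = m and Z = Z]) auto
  moreover have "B + Z * D - Z \<in> carrier_mat 1 m" "D - C * Z \<in> carrier_mat m m"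
    using assms Z by auto
  ultimately show ?thesis
    by blast
qed

text \<open>Dually, a lower shear turns the corner into \<open>a - B * W\<close>.\<close>

lemma pivot_one_row:
  fixes a :: "'a :: division_ring"
  assumes "B \<in> carrier_mat 1 m" "C \<in> carrier_mat m 1" "D \<in> carrier_mat m m" "k < m" "B $$ (0, k) \<noteq> 0"
  shows "\<exists>C'\<in>carrier_mat m 1. \<exists>D'\<in>carrier_mat m m.
    similar_mat (four_block_mat (mat1 a) B C D) (four_block_mat (mat1 1) B C' D')"
proof -
  define W where "W = mat m 1 (\<lambda>(i, j). if i = k then inverse (B $$ (0, k)) * (a - 1) else 0)"
  have W: "W \<in> carrier_mat m 1"
    by (simp add: W_def)
  have "(B * W) $$ (0, 0) = a - 1"
    using assms by (simp add: W_def scalar_prod_def mult_delta flip: mult.assoc)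
  then have "mat1 1 + B * W = mat1 a"
    using assms W by (intro eq_matI) auto
  moreover have "(W * mat1 a + C - (W * B + D) * W) + (W * B + D) * W = W * mat1 a + C"
    using assms W by (auto intro!: eq_matI simp del: index_mult_mat(1))
  ultimately have "similar_mat (four_block_mat (mat1 a) B C D)
      (four_block_mat (mat1 1) B (W * mat1 a + C - (W * B + D) * W) (W * B + D))"
    using assms W by (intro similar_lower_shear[where n = 1 and m = m and W = W]) auto
  moreover have "W * mat1 a + C - (W * B + D) * W \<in> carrier_mat m 1" "W * B + D \<in> carrier_mat m m"
    using assms W by auto
  ultimately show ?thesis
    by blast
qed

text \<open>A nonzero entry beside or below the corner suffices for one shear. Otherwise
  \<open>A\<close> is block diagonal with blocks \<open>a\<close> and \<open>D\<close>, and a lower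
  shear creates the column \<open>W * a - D * W\<close>. If this vanishes for all \<open>W\<close>,
  then \<open>D\<close> is \<open>a\<close> times the identity and \<open>a\<close> is
  central.\<close>

lemma pivot_one:
  fixes A :: "quat mat"
  assumes "A \<in> carrier_mat (Suc m) (Suc m)" "m > 0"
  shows "(\<exists>r. A = mat_diag (Suc m) (\<lambda>_. of_real r)) \<or>
    (\<exists>B\<in>carrier_mat 1 m. \<exists>C\<in>carrier_mat m 1. \<exists>D\<in>carrier_mat m m.
      similar_mat A (four_block_mat (mat1 1) B C D))"
proof -
  define a where "a = A $$ (0, 0)"
  define B where "B = mat 1 m (\<lambda>(i, j). A $$ (0, Suc j))"
  define C where "C = mat m 1 (\<lambda>(i, j). A $$ (Suc i, 0))"
  define D where "D = mat m m (\<lambda>(i, j). A $$ (Suc i, Suc j))"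
  have BCD: "B \<in> carrier_mat 1 m" "C \<in> carrier_mat m 1" "D \<in> carrier_mat m m"
    by (simp_all add: B_def C_def D_def)
  have A: "A = four_block_mat (mat1 a) B C D"
    using assms by (intro eq_matI) (auto simp: a_def B_def C_def D_def)
  consider k where "k < m" "C $$ (k, 0) \<noteq> 0" | k where "k < m" "B $$ (0, k) \<noteq> 0"
    | "\<And>k. k < m \<Longrightarrow> C $$ (k, 0) = 0" "\<And>k. k < m \<Longrightarrow> B $$ (0, k) = 0"
    by blast
  then show ?thesis
  proof cases
    case 1
    then show ?thesis
      unfolding A using pivot_one_column[OF BCD] BCD by blast
  next
    case 2
    then show ?thesis
      unfolding A using pivot_one_row[OF BCD] BCD by blast
  next
    case 3
    have B: "B = 0\<^sub>m 1 m" and C: "C = 0\<^sub>m m 1"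
      using 3 BCD by (auto intro!: eq_matI)
    show ?thesis
    proof (cases "\<forall>W\<in>carrier_mat m 1. D * W = W * mat1 a")
      case True
      have D: "D $$ (i, k) * h = (if i = k then h * a else 0)" if "i < m" "k < m" for i k h
      proof -
        \<comment> \<open>The test column is the \<open>k\<close>-th unit vector times an arbitrary
          quaternion \<open>h\<close>.\<close>
        define W where "W = mat m 1 (\<lambda>(i, j). if i = k then h else 0)"
        have "(D * W) $$ (i, 0) = (W * mat1 a) $$ (i, 0)"
          using True by (simp add: W_def)
        moreover have "(D * W) $$ (i, 0) = D $$ (i, k) * h"
          using that BCD by (simp add: W_def scalar_prod_def mult_delta)
        moreover have "(W * mat1 a) $$ (i, 0) = (if i = k then h * a else 0)"
          using that by (auto simp: W_def scalar_prod_def)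
        ultimately show ?thesis
          using that by simp
      qed
      \<comment> \<open>The value \<open>h = 1\<close> identifies \<open>D $$ (0, 0)\<close> with
        \<open>a\<close>, and then arbitrary \<open>h\<close> shows that \<open>a\<close> is
        central.\<close>
      have "a * h = h * a" for h
        using D[of 0 0 1] D[of 0 0 h] assms by simp
      then have "a \<in> \<real>"
        using quat_central_iff by blast
      then obtain r where "a = of_real r"
        by (rule Reals_cases)
      moreover have "A = mat_diag (Suc m) (\<lambda>_. a)"
      proof (rule eq_matI)
        fix i j assume "i < dim_row (mat_diag (Suc m) (\<lambda>_. a))" "j < dim_col (mat_diag (Suc m) (\<lambda>_. a))"
        then show "A $$ (i, j) = mat_diag (Suc m) (\<lambda>_. a) $$ (i, j)"
          using D[of "i - 1" "j - 1" 1] BCD unfolding A B C by (cases i; cases j) (auto simp: mat_diag_def)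
      qed (use assms in auto)
      ultimately show ?thesis
        by blast
    next
      case False
      then obtain W where W: "W \<in> carrier_mat m 1" "D * W \<noteq> W * mat1 a"
        by blast
      define C' where "C' = W * mat1 a - D * W"
      have C': "C' \<in> carrier_mat m 1"
        using W BCD by (auto simp: C'_def intro!: minus_carrier_mat mult_carrier_mat)
      have "C' + D * W = W * mat1 a + C" "D = W * B + D"
        using W BCD C' unfolding B C C'_def by (auto intro!: eq_matI simp del: index_mult_mat(1))
      then have sim: "similar_mat A (four_block_mat (mat1 a) B C' D)"
        unfolding A using W BCD C' by (intro similar_lower_shear[where n = 1 and m = m and W = W]) (auto simp: B)
      have "\<exists>k<m. C' $$ (k, 0) \<noteq> 0"
      proof (rule ccontr)
        assume *: "\<not> ?thesis"
        have "(W * mat1 a) $$ (k, 0) = (D * W) $$ (k, 0)" if "k < m" for k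
          using * that W BCD by (simp add: C'_def del: index_mult_mat(1))
        then have "D * W = W * mat1 a"
          using W BCD by (intro eq_matI) auto
        with W show False
          by simp
      qed
      then show ?thesis
        using pivot_one_column[OF BCD(1) C' BCD(3)] C' sim similar_mat_trans by blast
    qed
  qed
qed

text \<open>\<open>F\<close> collects forbidden real parts, which for unit quaternions means
  forbidden conjugacy classes. The conditions on \<open>b\<close> and \<open>c\<close> hold at every
  index, so \<open>case_nat\<close> can extend both without range conditions.\<close>

definition splits_into_units :: "nat \<Rightarrow> real set \<Rightarrow> quat mat \<Rightarrow> bool" where
  "splits_into_units n F A \<longleftrightarrow> (\<exists>L U b c. L \<in> carrier_mat n n \<and> U \<in> carrier_mat n n \<and> A = L * U \<and>
     similar_mat L (mat_diag n b) \<and> similar_mat U (mat_diag n c) \<and>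
     (\<forall>i. qnorm2 (b i) = 1 \<and> qnorm2 (c i) = 1 \<and> qre (b i) \<notin> F \<and> qre (c i) \<notin> F))"

lemma similar_mat_carrier:
  assumes "similar_mat A B" "B \<in> carrier_mat n n"
  obtains P Q where "P \<in> carrier_mat n n" "Q \<in> carrier_mat n n" "P * Q = 1\<^sub>m n" "Q * P = 1\<^sub>m n" "A = P * B * Q"
proof -
  obtain k P Q where k: "{A, B, P, Q} \<subseteq> carrier_mat k k" "P * Q = 1\<^sub>m k" "Q * P = 1\<^sub>m k" "A = P * B * Q"
    using similar_matD[OF assms(1)] by blast
  then have "k = n"
    using assms by auto
  with k that show ?thesis
    by blast
qed

lemma similar_mat_conj:
  assumes "P \<in> carrier_mat n n" "Q \<in> carrier_mat n n" "P * Q = 1\<^sub>m n" "Q * P = 1\<^sub>m n" "A \<in> carrier_mat n n"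
  shows "similar_mat (P * A * Q) A"
  using assms by (intro similar_matI[of _ _ P Q n]) auto

lemma conj_mult:
  assumes "P \<in> carrier_mat n n" "Q \<in> carrier_mat n n" "Q * P = 1\<^sub>m n" "A \<in> carrier_mat n n" "B \<in> carrier_mat n n"
  shows "P * A * Q * (P * B * Q) = P * (A * B) * (Q :: 'a :: semiring_1 mat)"
proof -
  have "Q * (P * (B * Q)) = Q * P * (B * Q)"
    using assms by (intro assoc_mult_mat[symmetric]) auto
  also have "\<dots> = B * Q"
    unfolding assms(3) using assms by simp
  finally show ?thesis
    using assms by (simp add: assoc_mult_mat[of _ n n _ n _ n])
qed

text \<open>Both factors are conjugated by the same \<open>P\<close>, and the inner
  \<open>Q * P\<close> cancels.\<close>

lemma splits_similar:
  assumes "similar_mat A B" "splits_into_units n F B"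
  shows "splits_into_units n F A"
proof -
  obtain L U b c where LU: "L \<in> carrier_mat n n" "U \<in> carrier_mat n n" "B = L * U"
     "similar_mat L (mat_diag n b)" "similar_mat U (mat_diag n c)"
     "\<forall>i. qnorm2 (b i) = 1 \<and> qnorm2 (c i) = 1 \<and> qre (b i) \<notin> F \<and> qre (c i) \<notin> F"
    using assms(2) unfolding splits_into_units_def by blast
  have "B \<in> carrier_mat n n"
    using LU by simp
  obtain P Q where PQ: "P \<in> carrier_mat n n" "Q \<in> carrier_mat n n" "P * Q = 1\<^sub>m n" "Q * P = 1\<^sub>m n" "A = P * B * Q"
    using similar_mat_carrier[OF assms(1) \<open>B \<in> carrier_mat n n\<close>] .
  have "A = P * L * Q * (P * U * Q)"
    unfolding PQ(5) LU(3) using PQ LU by (intro conj_mult[symmetric])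
  moreover have "similar_mat (P * L * Q) (mat_diag n b)" "similar_mat (P * U * Q) (mat_diag n c)"
    using similar_mat_conj[OF PQ(1-4)] LU similar_mat_trans by blast+
  moreover have "P * L * Q \<in> carrier_mat n n" "P * U * Q \<in> carrier_mat n n"
    using PQ LU by (auto intro!: mult_carrier_mat)
  ultimately show ?thesis
    unfolding splits_into_units_def using LU(6) by blast
qed

text \<open>This covers one by one matrices and the real scalar matrices left over by
  \<open>pivot_one\<close>.\<close>

lemma splits_scalar:
  assumes "qnorm2 q = 1" "finite F"
  shows "splits_into_units n F (mat_diag n (\<lambda>_. q))"
proof -
  obtain b c where "qnorm2 b = 1" "qnorm2 c = 1" "q = b * c" "qre b \<notin> F" "qre c \<notin> F"
    using unit_quat_factor[OF assms] by blast
  then show ?thesis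
    unfolding splits_into_units_def
    by (intro exI[of _ "mat_diag n (\<lambda>_. b)"] exI[of _ "mat_diag n (\<lambda>_. c)"] exI[of _ "\<lambda>_. b"] exI[of _ "\<lambda>_. c"])
       (auto intro!: similar_mat_refl)
qed

text \<open>Enlarging \<open>F\<close> along the induction keeps the diagonal entries of the two triangular
  factors pairwise non-conjugate, which makes the factors diagonalizable.\<close>

lemma splits_if_ddet_one:
  assumes "A \<in> carrier_mat (Suc n) (Suc n)" "ddet A = 1" "finite F"
  shows "splits_into_units (Suc n) F A"
  using assms
proof (induction n arbitrary: A F)
  case 0
  have "A = mat_diag 1 (\<lambda>_. A $$ (0, 0))"
    using 0 by (intro eq_matI) (auto simp: mat_diag_def)
  moreover have "qnorm2 (A $$ (0, 0)) = 1"
    using 0 ddet_scalar[of A] by simp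
  ultimately show ?case
    using splits_scalar[of "A $$ (0, 0)" F 1] 0 by simp
next
  case (Suc n)
  consider r where "A = mat_diag (Suc (Suc n)) (\<lambda>_. of_real r)"
    | B C D where "B \<in> carrier_mat 1 (Suc n)" "C \<in> carrier_mat (Suc n) 1" "D \<in> carrier_mat (Suc n) (Suc n)"
        "similar_mat A (four_block_mat (mat1 1) B C D)"
    using pivot_one[OF Suc.prems(1)] by blast
  then show ?case
  proof cases
    case 1
    \<comment> \<open>The determinant is a power of the nonnegative real
      \<open>qnorm2 (of_real r)\<close>, which therefore equals \<open>1\<close>.\<close>
    have "1 = complex_of_real (\<Prod>i<Suc (Suc n). qnorm2 (A $$ (i, i)))"
      unfolding Suc.prems(2)[symmetric]
      by (rule ddet_upper_triangular[OF Suc.prems(1)]) (simp add: 1 mat_diag_def)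
    also have "(\<Prod>i<Suc (Suc n). qnorm2 (A $$ (i, i))) = (\<Prod>i<Suc (Suc n). qnorm2 (of_real r))"
      by (rule prod.cong) (simp_all add: 1 mat_diag_def)
    also have "\<dots> = qnorm2 (of_real r) ^ Suc (Suc n)"
      by (simp only: prod_constant card_lessThan)
    finally have "complex_of_real (qnorm2 (of_real r) ^ Suc (Suc n)) = 1"
      by (rule sym)
    then have "qnorm2 (of_real r) ^ Suc (Suc n) = 1"
      by (simp only: of_real_eq_1_iff)
    then have "qnorm2 (of_real r) = 1"
      using power_eq_imp_eq_base[of "qnorm2 (of_real r)" "Suc (Suc n)" 1] qnorm2_nonneg by simp
    then show ?thesis
      unfolding 1 by (intro splits_scalar Suc.prems)
  next
    case 2
    \<comment> \<open>The pivot \<open>1\<close> is split into two units, one for the corner of each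
      factor.\<close>
    obtain b c where bc: "qnorm2 b = 1" "qnorm2 c = 1" "b * c = 1" "qre b \<notin> F" "qre c \<notin> F"
      using unit_quat_factor[of 1 F] Suc.prems by auto
    \<comment> \<open>The Schur complement of the pivot. It inherits determinant one, and in its own
      splitting the real parts of \<open>b\<close> and \<open>c\<close> are forbidden as
      well.\<close>
    define E where "E = D - C * B"
    have E: "E \<in> carrier_mat (Suc n) (Suc n)"
      using 2 by (auto simp: E_def intro!: minus_carrier_mat mult_carrier_mat)
    let ?M = "four_block_mat (mat1 1) B C D"
    have "C * B + E = D"
      using 2 unfolding E_def by (auto intro!: eq_matI simp del: index_mult_mat(1))
    then have "?M = four_block_mat (mat1 1) (0\<^sub>m 1 (Suc n)) C (1\<^sub>m (Suc n)) *
        four_block_mat (mat1 1) B (0\<^sub>m (Suc n) 1) E"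
      unfolding mat1_one using 2 E
      by (subst mult_four_block_mat[of _ 1 1 _ "Suc n" _ "Suc n" _ _ 1 _ "Suc n"]) auto
    also have "ddet \<dots> = ddet E"
      unfolding mat1_one using 2 E by (subst ddet_mult[of _ "1 + Suc n"])
        (use ddet_lower_block[of "1\<^sub>m 1" 1 C "Suc n" "1\<^sub>m (Suc n)"]
          ddet_upper_block[of "1\<^sub>m 1" 1 B "Suc n" E] in auto)
    finally have "ddet E = 1"
      using ddet_similar[OF 2(4)] Suc.prems by simp
    then have "splits_into_units (Suc n) (insert (qre b) (insert (qre c) F)) E"
      using Suc.IH[OF E] Suc.prems by simp
    then obtain L U f g where LU: "L \<in> carrier_mat (Suc n) (Suc n)" "U \<in> carrier_mat (Suc n) (Suc n)" "E = L * U"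
       "similar_mat L (mat_diag (Suc n) f)" "similar_mat U (mat_diag (Suc n) g)"
       and fg: "\<And>i. qnorm2 (f i) = 1" "\<And>i. qnorm2 (g i) = 1"
         "\<And>i. qre (f i) \<noteq> qre b" "\<And>i. qre (f i) \<notin> F" "\<And>i. qre (g i) \<noteq> qre c" "\<And>i. qre (g i) \<notin> F"
      unfolding splits_into_units_def by blast
    \<comment> \<open>The factors \<open>b\<close> and \<open>c\<close> are inserted so that
      \<open>b * c = 1\<close> cancels in every block; the last block becomes
      \<open>C * B + L * U = C * B + E = D\<close>.\<close>
    let ?L = "four_block_mat (mat1 b) (0\<^sub>m 1 (Suc n)) (C * mat1 b) L"
    let ?U = "four_block_mat (mat1 c) (mat1 c * B) (0\<^sub>m (Suc n) 1) U"
    have "mat1 b * (mat1 c * B) = mat1 b * mat1 c * B"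
      using 2 by (intro assoc_mult_mat[symmetric]) auto
    then have ul: "mat1 b * (mat1 c * B) = B"
      unfolding mat1_mult bc(3) mat1_one using 2 by simp
    have "C * mat1 b * mat1 c = C * (mat1 b * mat1 c)"
      using 2 by (intro assoc_mult_mat) auto
    then have ll: "C * mat1 b * mat1 c = C"
      unfolding mat1_mult bc(3) mat1_one using 2 by simp
    have "C * mat1 b * (mat1 c * B) = C * (mat1 b * (mat1 c * B))"
      using 2 by (intro assoc_mult_mat) auto
    then have lr: "C * mat1 b * (mat1 c * B) + L * U = D"
      unfolding ul using \<open>C * B + E = D\<close> LU by simp
    have "?M = ?L * ?U"
      by (subst mult_four_block_mat[of _ 1 1 _ "Suc n" _ "Suc n" _ _ 1 _ "Suc n"], (use 2 LU in auto)[8],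
          unfold ul ll lr mat1_mult bc(3), use 2 LU in simp)
    moreover have "similar_mat ?L (mat_diag (Suc (Suc n)) (case_nat b f))"
      using 2 LU fg bc by (intro similar_diag_lower) auto
    moreover have "similar_mat ?U (mat_diag (Suc (Suc n)) (case_nat c g))"
      using 2 LU fg bc by (intro similar_diag_upper) auto
    moreover have "?L \<in> carrier_mat (Suc (Suc n)) (Suc (Suc n))" "?U \<in> carrier_mat (Suc (Suc n)) (Suc (Suc n))"
      using four_block_carrier_mat[of "mat1 b" 1 1 L "Suc n" "Suc n"]
        four_block_carrier_mat[of "mat1 c" 1 1 U "Suc n" "Suc n"] LU by auto
    moreover have "qnorm2 (case_nat b f i) = 1 \<and> qnorm2 (case_nat c g i) = 1 \<and>
        qre (case_nat b f i) \<notin> F \<and> qre (case_nat c g i) \<notin> F" for i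
      using bc fg by (simp split: nat.split)
    ultimately have "splits_into_units (Suc (Suc n)) F ?M"
      unfolding splits_into_units_def by blast
    then show ?thesis
      using splits_similar 2(4) by blast
  qed
qed

section \<open>Commutators and differences\<close>

text \<open>These matrices are values of every admissible polynomial, see
  \<open>pure_diagonalizable_in_poly_image\<close>.\<close>

definition pure_diagonalizable :: "nat \<Rightarrow> quat mat \<Rightarrow> bool" where
  "pure_diagonalizable n X \<longleftrightarrow> (\<exists>d. (\<forall>i. d i \<noteq> 0 \<and> qre (d i) = 0) \<and> similar_mat X (mat_diag n d))"

section \<open>Commutators in the matrix algebra\<close>

lemma mat_alg_simps:
  "carrier (mat_alg n) = carrier_mat n n" "\<one>\<^bsub>mat_alg n\<^esub> = 1\<^sub>m n" "\<zero>\<^bsub>mat_alg n\<^esub> = 0\<^sub>m n n"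
  "A \<otimes>\<^bsub>mat_alg n\<^esub> B = A * B" "A \<oplus>\<^bsub>mat_alg n\<^esub> B = A + B" "r \<odot>\<^bsub>mat_alg n\<^esub> A = map_mat ((*\<^sub>R) r) A"
  by (simp_all add: mat_alg_def ring_mat_def)

lemma monoid_mat_alg: "monoid (mat_alg n)"
  using ring_mat_alg ring.is_monoid by blast

lemma mat_alg_inverse:
  assumes "A \<in> carrier_mat n n" "B \<in> carrier_mat n n" "A * B = 1\<^sub>m n" "B * A = 1\<^sub>m n"
  shows "A \<in> Units (mat_alg n)" "inv\<^bsub>mat_alg n\<^esub> A = B"
proof -
  show "A \<in> Units (mat_alg n)"
    using assms by (auto simp: Units_def mat_alg_simps)
  show "inv\<^bsub>mat_alg n\<^esub> A = B"
    by (rule monoid.inv_char[OF monoid_mat_alg]) (use assms in \<open>auto simp: mat_alg_simps\<close>)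
qed

text \<open>The map \<open>G\<close>, which conjugates diagonal matrices by a fixed
  \<open>P\<close>, is multiplicative and unital. It carries the entrywise commutators of pure
  quaternions to a commutator of matrices.\<close>

lemma pure_commutator_if_similar_unit_diag:
  assumes "similar_mat L (mat_diag n c)" "\<And>i. qnorm2 (c i) = 1"
  shows "\<exists>X Y. pure_diagonalizable n X \<and> pure_diagonalizable n Y \<and>
    X \<in> Units (mat_alg n) \<and> Y \<in> Units (mat_alg n) \<and>
    L = X * Y * inv\<^bsub>mat_alg n\<^esub> X * inv\<^bsub>mat_alg n\<^esub> Y"
proof -
  obtain P Q where PQ: "P \<in> carrier_mat n n" "Q \<in> carrier_mat n n" "P * Q = 1\<^sub>m n" "Q * P = 1\<^sub>m n"
      "L = P * mat_diag n c * Q"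
    using similar_mat_carrier[OF assms(1) mat_diag_dim] by blast
  have "\<exists>a b. a \<noteq> 0 \<and> b \<noteq> 0 \<and> qre a = 0 \<and> qre b = 0 \<and> c i = b * a * inverse b * inverse a" for i
    by (rule unit_quat_commutator[OF assms(2)])
  then obtain a b where ab: "\<And>i. a i \<noteq> 0" "\<And>i. b i \<noteq> 0" "\<And>i. qre (a i) = 0" "\<And>i. qre (b i) = 0"
      "\<And>i. c i = b i * a i * inverse (b i) * inverse (a i)"
    by metis
  define G where "G f = P * mat_diag n f * Q" for f
  have G: "G f \<in> carrier_mat n n" for f
    using PQ by (auto simp: G_def intro!: mult_carrier_mat)
  have mult: "G f * G g = G (\<lambda>i. f i * g i)" for f g
    unfolding G_def using PQ by (subst conj_mult[of _ n]) auto
  have one: "G (\<lambda>_. 1) = 1\<^sub>m n"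
    using PQ by (simp add: G_def)
  have inv: "G f \<in> Units (mat_alg n)" "inv\<^bsub>mat_alg n\<^esub> (G f) = G (\<lambda>i. inverse (f i))" if "\<And>i. f i \<noteq> 0" for f
    using that mat_alg_inverse[of "G f" n "G (\<lambda>i. inverse (f i))"] G by (simp_all add: mult one)
  have pure: "pure_diagonalizable n (G f)" if "\<And>i. f i \<noteq> 0" "\<And>i. qre (f i) = 0" for f
    using that similar_mat_conj[OF PQ(1-4), of "mat_diag n f"] unfolding pure_diagonalizable_def G_def by auto
  have "L = G b * G a * inv\<^bsub>mat_alg n\<^esub> (G b) * inv\<^bsub>mat_alg n\<^esub> (G a)"
  proof -
    have "L = G c"
      by (simp add: G_def PQ(5))
    also have "c = (\<lambda>i. b i * a i * inverse (b i) * inverse (a i))"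
      using ab(5) by blast
    finally show ?thesis
      using ab by (simp add: inv mult)
  qed
  then show ?thesis
    using pure inv ab by metis
qed

lemma two_pure_commutators:
  assumes "A \<in> carrier_mat n n" "n > 0" "ddet A = 1"
  shows "\<exists>X Y Z W. (\<forall>M\<in>{X, Y, Z, W}. pure_diagonalizable n M \<and> M \<in> Units (mat_alg n)) \<and>
    A = X \<otimes>\<^bsub>mat_alg n\<^esub> Y \<otimes>\<^bsub>mat_alg n\<^esub> inv\<^bsub>mat_alg n\<^esub> X \<otimes>\<^bsub>mat_alg n\<^esub> inv\<^bsub>mat_alg n\<^esub> Y
      \<otimes>\<^bsub>mat_alg n\<^esub> Z \<otimes>\<^bsub>mat_alg n\<^esub> W \<otimes>\<^bsub>mat_alg n\<^esub> inv\<^bsub>mat_alg n\<^esub> Z \<otimes>\<^bsub>mat_alg n\<^esub> inv\<^bsub>mat_alg n\<^esub> W"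
proof -
  obtain m where n: "n = Suc m"
    using assms(2) by (cases n) auto
  obtain L U b c where LU: "A = L * U" "similar_mat L (mat_diag n b)" "similar_mat U (mat_diag n c)"
      "\<And>i. qnorm2 (b i) = 1" "\<And>i. qnorm2 (c i) = 1"
    \<comment> \<open>No real part is forbidden at the outermost level.\<close>
    using splits_if_ddet_one[of A m "{}"] assms unfolding n splits_into_units_def by auto
  obtain X Y where XY: "pure_diagonalizable n X" "pure_diagonalizable n Y"
    "X \<in> Units (mat_alg n)" "Y \<in> Units (mat_alg n)"
    "L = X * Y * inv\<^bsub>mat_alg n\<^esub> X * inv\<^bsub>mat_alg n\<^esub> Y"
    using pure_commutator_if_similar_unit_diag[OF LU(2,4)] by blast
  obtain Z W where ZW: "pure_diagonalizable n Z" "pure_diagonalizable n W"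
    "Z \<in> Units (mat_alg n)" "W \<in> Units (mat_alg n)"
    "U = Z * W * inv\<^bsub>mat_alg n\<^esub> Z * inv\<^bsub>mat_alg n\<^esub> W"
    using pure_commutator_if_similar_unit_diag[OF LU(3,5)] by blast
  interpret monoid "mat_alg n"
    by (rule monoid_mat_alg)
  have "A = L \<otimes>\<^bsub>mat_alg n\<^esub> U"
    by (simp add: LU(1) mat_alg_simps)
  also have "\<dots> = X \<otimes>\<^bsub>mat_alg n\<^esub> Y \<otimes>\<^bsub>mat_alg n\<^esub> inv\<^bsub>mat_alg n\<^esub> X \<otimes>\<^bsub>mat_alg n\<^esub> inv\<^bsub>mat_alg n\<^esub> Y
      \<otimes>\<^bsub>mat_alg n\<^esub> Z \<otimes>\<^bsub>mat_alg n\<^esub> W \<otimes>\<^bsub>mat_alg n\<^esub> inv\<^bsub>mat_alg n\<^esub> Z \<otimes>\<^bsub>mat_alg n\<^esub> inv\<^bsub>mat_alg n\<^esub> W"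
    unfolding XY(5) ZW(5) mat_alg_simps(4)[symmetric, where n = n] using XY(3,4) ZW(3,4) by (simp add: m_assoc Units_closed)
  finally show ?thesis
    using XY ZW by blast
qed

text \<open>\<open>ddet\<close> is multiplicative with commuting values, so it is \<open>1\<close>
  on commutators and hence on the group they generate.\<close>

lemma SL_ddet:
  assumes "A \<in> SL n"
  shows "A \<in> carrier_mat n n \<and> ddet A = 1"
proof -
  interpret monoid "mat_alg n"
    by (rule monoid_mat_alg)
  have c: "X \<in> carrier_mat n n" if "X \<in> Units (mat_alg n)" for X
    using that Units_closed by (simp add: mat_alg_simps)
  have inv: "ddet X * ddet (inv\<^bsub>mat_alg n\<^esub> X) = 1" if "X \<in> Units (mat_alg n)" for X
    using that Units_r_inv[OF that] ddet_mult[of X n "inv\<^bsub>mat_alg n\<^esub> X"] c by (simp add: mat_alg_simps)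
  let ?S = "derived_set (GL n) (carrier (GL n))"
  have S: "X \<in> Units (mat_alg n) \<and> ddet X = 1" if X: "X \<in> ?S" for X
  proof -
    obtain g h where gh: "g \<in> Units (mat_alg n)" "h \<in> Units (mat_alg n)"
      "X = g \<otimes>\<^bsub>mat_alg n\<^esub> h \<otimes>\<^bsub>mat_alg n\<^esub> inv\<^bsub>mat_alg n\<^esub> g \<otimes>\<^bsub>mat_alg n\<^esub> inv\<^bsub>mat_alg n\<^esub> h"
      using X by (auto simp: GL_def units_of_carrier units_of_mult units_of_inv)
    let ?g = "inv\<^bsub>mat_alg n\<^esub> g" and ?h = "inv\<^bsub>mat_alg n\<^esub> h"
    have "g \<in> carrier_mat n n" "h \<in> carrier_mat n n" "?g \<in> carrier_mat n n" "?h \<in> carrier_mat n n"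
      using gh c by auto
    then have "ddet X = ddet g * ddet h * ddet ?g * ddet ?h"
      unfolding gh(3) mat_alg_simps(4)
      using ddet_mult[of g n h] ddet_mult[of "g * h" n ?g] ddet_mult[of "g * h * ?g" n ?h]
      by (metis mult_carrier_mat)
    also have "\<dots> = (ddet g * ddet (inv\<^bsub>mat_alg n\<^esub> g)) * (ddet h * ddet (inv\<^bsub>mat_alg n\<^esub> h))"
      by (simp add: mult_ac)
    also have "\<dots> = 1"
      using inv gh(1,2) by simp
    finally show ?thesis
      using gh by simp
  qed
  have "X \<in> Units (mat_alg n) \<and> ddet X = 1" if "X \<in> generate (GL n) ?S" for X
    using that
  proof induction
    case one
    then show ?case
      by (simp add: GL_def units_of_one) (simp add: mat_alg_simps)
  next
    case (incl h)
    then show ?case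
      using S by blast
  next
    case (inv h)
    then have "h \<in> Units (mat_alg n)" "ddet h = 1"
      using S by blast+
    then show ?case
      using \<open>\<And>X. X \<in> Units (mat_alg n) \<Longrightarrow> ddet X * ddet (inv\<^bsub>mat_alg n\<^esub> X) = 1\<close>[of h]
      by (simp add: GL_def units_of_inv)
  next
    case (eng h1 h2)
    then have "h1 \<otimes>\<^bsub>mat_alg n\<^esub> h2 \<in> Units (mat_alg n)" "ddet (h1 * h2) = 1"
      using c ddet_mult[of h1 n h2] by auto
    then show ?case
      by (simp add: GL_def units_of_mult mat_alg_simps)
  qed
  then show ?thesis
    using assms c unfolding SL_def derived_def by blast
qed

text \<open>The hypotheses are the triangle inequalities for sides \<open>r\<close>,
  \<open>s\<close>, \<open>t\<close>. Such a triangle with side \<open>b\<close> is placed in the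
  plane of \<open>b\<close> and an orthogonal \<open>w\<close>; the other two sides are
  \<open>l\<close> and \<open>m\<close>.\<close>

lemma quat_norm_difference:
  assumes "r > 0" "s > 0" "\<bar>r - s\<bar> \<le> t" "t \<le> r + s" "qnorm2 b = t\<^sup>2"
  shows "\<exists>l m. l - m = b \<and> qnorm2 l = r\<^sup>2 \<and> qnorm2 m = s\<^sup>2"
proof (cases "b = 0")
  case True
  then have "r = s"
    using assms by auto
  then show ?thesis
    using True by (intro exI[of _ "of_real r"]) (simp add: qnorm2_of_real)
next
  case False
  then have t: "t \<noteq> 0"
    using assms(5) by auto
  obtain w where w: "w \<noteq> 0" "qre w * qre b + qi w * qi b + qj w * qj b + qk w * qk b = 0"
  proof (cases "qre b = 0 \<and> qi b = 0")
    case True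
    then show ?thesis
      by (intro that[of 1]) simp_all
  next
    case False
    then show ?thesis
      by (intro that[of "Quat (qi b) (- qre b) 0 0"]) (auto simp: quat_eq_iff)
  qed
  \<comment> \<open>The foot of the altitude on \<open>b\<close>, as given by the law of
    cosines.\<close>
  define x where "x = (t\<^sup>2 + r\<^sup>2 - s\<^sup>2) / (2 * t\<^sup>2)"
  have "0 \<le> r\<^sup>2 - x\<^sup>2 * t\<^sup>2"
  proof -
    have "(r\<^sup>2 - x\<^sup>2 * t\<^sup>2) * (4 * t\<^sup>2) = 4 * r\<^sup>2 * t\<^sup>2 - (t\<^sup>2 + r\<^sup>2 - s\<^sup>2)\<^sup>2"
      using t by (simp add: x_def power_divide field_simps power2_eq_square)
    \<comment> \<open>This is the factorization behind Heron's formula; each factor is nonnegative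
      by triangle inequalities.\<close>
    also have "\<dots> = ((r + t)\<^sup>2 - s\<^sup>2) * (s\<^sup>2 - (r - t)\<^sup>2)"
      by (simp add: power2_eq_square algebra_simps)
    also have "\<dots> \<ge> 0"
    proof (rule mult_nonneg_nonneg)
      show "0 \<le> (r + t)\<^sup>2 - s\<^sup>2"
        using assms by (simp add: power_mono)
      have "\<bar>r - t\<bar> \<le> \<bar>s\<bar>"
        using assms by auto
      then show "0 \<le> s\<^sup>2 - (r - t)\<^sup>2"
        by (simp add: abs_le_square_iff)
    qed
    finally show ?thesis
      using t by (simp add: zero_le_mult_iff)
  qed
  define y where "y = sqrt ((r\<^sup>2 - x\<^sup>2 * t\<^sup>2) / qnorm2 w)"
  have y: "y\<^sup>2 * qnorm2 w = r\<^sup>2 - x\<^sup>2 * t\<^sup>2"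
    using \<open>0 \<le> r\<^sup>2 - x\<^sup>2 * t\<^sup>2\<close> w(1) qnorm2_nonneg[of w] by (simp add: y_def)
  have norm: "qnorm2 (u *\<^sub>R b + v *\<^sub>R w) = u\<^sup>2 * qnorm2 b + v\<^sup>2 * qnorm2 w" for u v
  proof -
    have "qnorm2 (u *\<^sub>R b + v *\<^sub>R w) = u\<^sup>2 * qnorm2 b + v\<^sup>2 * qnorm2 w
        + 2 * u * v * (qre w * qre b + qi w * qi b + qj w * qj b + qk w * qk b)"
      by (simp add: qnorm2_def power2_eq_square algebra_simps)
    then show ?thesis
      by (simp add: w(2))
  qed
  have "qnorm2 (x *\<^sub>R b + y *\<^sub>R w) = r\<^sup>2"
    unfolding norm y assms(5) by simp
  moreover have "qnorm2 ((x - 1) *\<^sub>R b + y *\<^sub>R w) = s\<^sup>2"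
    unfolding norm y assms(5) using t by (simp add: x_def power2_eq_square field_simps)
  moreover have "(x *\<^sub>R b + y *\<^sub>R w) - ((x - 1) *\<^sub>R b + y *\<^sub>R w) = b"
    by (simp add: algebra_simps)
  ultimately show ?thesis
    by blast
qed

text \<open>If \<open>b * c\<close> is at least \<open>d\<close>, the pairs
  \<open>(b, d / b)\<close> and \<open>(d / c, c)\<close> work. Otherwise both pairs can be equal,
  and only \<open>b \<le> 2 * r1\<close> and \<open>c \<le> 2 * r2\<close> remain to be met.\<close>

lemma triangle_products_two:
  fixes b c d :: real
  assumes "b \<ge> 0" "c \<ge> 0" "d > 0"
  shows "\<exists>r1 r2 s1 s2. r1 > 0 \<and> r2 > 0 \<and> s1 > 0 \<and> s2 > 0 \<and> r1 * r2 = d \<and> s1 * s2 = d \<and>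
    \<bar>r1 - s1\<bar> \<le> b \<and> b \<le> r1 + s1 \<and> \<bar>r2 - s2\<bar> \<le> c \<and> c \<le> r2 + s2"
proof (cases "b * c \<ge> d")
  case True
  then have "b \<noteq> 0" "c \<noteq> 0"
    using assms(3) by auto
  then have bc: "b > 0" "c > 0"
    using assms by auto
  have "d / c \<le> b" "d / b \<le> c" "d / c > 0" "d / b > 0"
    using bc True assms by (simp_all add: field_simps)
  then show ?thesis
    using bc assms by (intro exI[of _ b] exI[of _ "d / b"] exI[of _ "d / c"] exI[of _ c]) auto
next
  case False
  show ?thesis
  proof (cases "b = 0")
    case True
    have "c \<le> 2 * (d / (d / (c + 1)))"
      using assms by (simp add: field_simps)
    then show ?thesis
      using True assms
      by (intro exI[of _ "d / (c + 1)"] exI[of _ "c + 1"]) (auto simp: field_simps)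
  next
    case b: False
    then have "c \<le> d / b" "d / b > 0" "b > 0"
      using assms False by (auto simp: field_simps)
    then show ?thesis
      using assms by (intro exI[of _ b] exI[of _ "d / b"]) auto
  qed
qed

text \<open>The induction starts with two indices: a single one would force \<open>r = s = d\<close>
  and fail for large \<open>t\<close>. Each further index gets \<open>t i + 1\<close> on both sides,
  and \<open>d\<close> is divided by this factor.\<close>

lemma triangle_products:
  fixes t :: "nat \<Rightarrow> real"
  assumes "\<And>i. t i \<ge> 0" "d > 0"
  shows "\<exists>r s. (\<forall>i. r i > 0 \<and> s i > 0 \<and> \<bar>r i - s i\<bar> \<le> t i \<and> t i \<le> r i + s i) \<and>
    (\<Prod>i<Suc (Suc n). r i) = d \<and> (\<Prod>i<Suc (Suc n). s i) = d"
  using assms(2)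
proof (induction n arbitrary: d)
  case 0
  obtain r1 r2 s1 s2 where "r1 > 0" "r2 > 0" "s1 > 0" "s2 > 0" "r1 * r2 = d" "s1 * s2 = d"
    "\<bar>r1 - s1\<bar> \<le> t 0" "t 0 \<le> r1 + s1" "\<bar>r2 - s2\<bar> \<le> t 1" "t 1 \<le> r2 + s2"
    using triangle_products_two[OF assms(1) assms(1) 0, of 0 1] by blast
  then show ?case
    using assms(1)
    \<comment> \<open>Indices from \<open>2\<close> on lie outside the product;
      \<open>t i + 1\<close> keeps their inequalities true.\<close>
    by (intro exI[of _ "\<lambda>i. if i = 0 then r1 else if i = 1 then r2 else t i + 1"]
              exI[of _ "\<lambda>i. if i = 0 then s1 else if i = 1 then s2 else t i + 1"])
       (auto intro: add_nonneg_pos simp: add_nonneg_pos)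
next
  case (Suc n)
  let ?e = "t (Suc (Suc n)) + 1"
  have e: "?e > 0"
    using assms(1)[of "Suc (Suc n)"] by simp
  then have "d / ?e > 0"
    using Suc.prems by simp
  then obtain r s where rs: "\<forall>i. r i > 0 \<and> s i > 0 \<and> \<bar>r i - s i\<bar> \<le> t i \<and> t i \<le> r i + s i"
    "(\<Prod>i<Suc (Suc n). r i) = d / ?e" "(\<Prod>i<Suc (Suc n). s i) = d / ?e"
    using Suc.IH by blast
  let ?u = "\<lambda>f i. if i = Suc (Suc n) then ?e else (f :: nat \<Rightarrow> real) i"
  have prod: "(\<Prod>i<Suc (Suc (Suc n)). ?u f i) = (\<Prod>i<Suc (Suc n). f i) * ?e" for f
  proof -
    have "(\<Prod>i<Suc (Suc n). ?u f i) = (\<Prod>i<Suc (Suc n). f i)"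
      by (rule prod.cong) auto
    then show ?thesis
      by (subst prod.lessThan_Suc) simp
  qed
  show ?case
  proof (intro exI conjI allI)
    show "(\<Prod>i<Suc (Suc (Suc n)). ?u r i) = d" "(\<Prod>i<Suc (Suc (Suc n)). ?u s i) = d"
      unfolding prod rs using e by simp_all
  qed (use rs(1) e assms(1)[of "Suc (Suc n)"] in auto)
qed

text \<open>\<open>C\<close> takes the part of \<open>B\<close> below the diagonal and
  \<open>D\<close> the negative of the part above it. The diagonal entries of \<open>B\<close> are
  split as \<open>l i - m i\<close>, with norms \<open>r i\<close> and \<open>s i\<close> whose
  products over the diagonal are \<open>1\<close>.\<close>

lemma difference_of_ddet_one:
  assumes "B \<in> carrier_mat n n" "n \<ge> 2"
  shows "\<exists>C D. C \<in> carrier_mat n n \<and> D \<in> carrier_mat n n \<and> ddet C = 1 \<and> ddet D = 1 \<and> B = C - D"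
proof -
  obtain k where n: "n = Suc (Suc k)"
    using assms(2) by (metis Suc_le_D numeral_2_eq_2 Suc_le_mono)
  define t where "t i = sqrt (qnorm2 (B $$ (i, i)))" for i
  have t: "t i \<ge> 0" "qnorm2 (B $$ (i, i)) = (t i)\<^sup>2" for i
    using qnorm2_nonneg by (simp_all add: t_def)
  obtain r s where rs: "\<And>i. r i > 0" "\<And>i. s i > 0" "\<And>i. \<bar>r i - s i\<bar> \<le> t i" "\<And>i. t i \<le> r i + s i"
    "(\<Prod>i<n. r i) = 1" "(\<Prod>i<n. s i) = 1"
    using triangle_products[of t 1 k] t(1) unfolding n by auto
  have "\<exists>l m. l - m = B $$ (i, i) \<and> qnorm2 l = (r i)\<^sup>2 \<and> qnorm2 m = (s i)\<^sup>2" for i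
    using quat_norm_difference[OF rs(1-4) t(2)] .
  then obtain l m where lm: "\<And>i. l i - m i = B $$ (i, i)" "\<And>i. qnorm2 (l i) = (r i)\<^sup>2" "\<And>i. qnorm2 (m i) = (s i)\<^sup>2"
    by metis
  define C where "C = mat n n (\<lambda>(i, j). if i = j then l i else if j < i then B $$ (i, j) else 0)"
  define D where "D = mat n n (\<lambda>(i, j). if i = j then m i else if i < j then - B $$ (i, j) else 0)"
  have "ddet C = of_real (\<Prod>i<n. (r i)\<^sup>2)"
    by (subst ddet_lower_triangular[of _ n]) (auto simp: C_def lm)
  moreover have "ddet D = of_real (\<Prod>i<n. (s i)\<^sup>2)"
    by (subst ddet_upper_triangular[of _ n]) (auto simp: D_def lm)
  moreover have "B = C - D"
    using assms(1) lm(1) by (intro eq_matI) (auto simp: C_def D_def)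
  ultimately show ?thesis
    using rs(5,6) by (intro exI[of _ C] exI[of _ D]) (simp add: C_def D_def flip: prod_power_distrib)
qed

section \<open>Values of multilinear polynomials\<close>

text \<open>Induction on words, then on the finite set of keys. It serves to move a conjugation of
  matrices through an evaluation.\<close>

lemma poly_eval_hom:
  assumes "ring R" "ring S" "h \<in> carrier R \<rightarrow> carrier S"
    and "\<And>x y. x \<in> carrier R \<Longrightarrow> y \<in> carrier R \<Longrightarrow> h (x \<oplus>\<^bsub>R\<^esub> y) = h x \<oplus>\<^bsub>S\<^esub> h y"
    and "\<And>x y. x \<in> carrier R \<Longrightarrow> y \<in> carrier R \<Longrightarrow> h (x \<otimes>\<^bsub>R\<^esub> y) = h x \<otimes>\<^bsub>S\<^esub> h y"
    and "h \<one>\<^bsub>R\<^esub> = \<one>\<^bsub>S\<^esub>" "h \<zero>\<^bsub>R\<^esub> = \<zero>\<^bsub>S\<^esub>"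
    and smult: "\<And>r x. x \<in> carrier R \<Longrightarrow> r \<odot>\<^bsub>R\<^esub> x \<in> carrier R"
      "\<And>r x. x \<in> carrier R \<Longrightarrow> h (r \<odot>\<^bsub>R\<^esub> x) = r \<odot>\<^bsub>S\<^esub> h x"
    and a: "\<And>i. a i \<in> carrier R"
  shows "h (poly_eval R p a) = poly_eval S p (\<lambda>i. h (a i))"
proof -
  interpret R: ring R by fact
  interpret S: ring S by fact
  have w: "word_eval R a w \<in> carrier R \<and> h (word_eval R a w) = word_eval S (\<lambda>i. h (a i)) w" for w
    by (induction w) (simp_all add: word_eval_def assms a)
  let ?f = "\<lambda>w. Poly_Mapping.lookup p w \<odot>\<^bsub>R\<^esub> word_eval R a w"
  let ?g = "\<lambda>w. Poly_Mapping.lookup p w \<odot>\<^bsub>S\<^esub> word_eval S (\<lambda>i. h (a i)) w"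
  have f: "?f w \<in> carrier R" for w
    using w[of w] smult by simp
  have hf: "h (?f w) = ?g w" for w
    using w[of w] smult(2) by simp
  have "?g w \<in> carrier S" for w
    using funcset_mem[OF assms(3) f[of w]] unfolding hf .
  note fg = f hf this
  have "h (finsum R ?f K) = finsum S ?g K" if "finite K" for K
    using that
  proof induction
    case empty
    then show ?case
      by (simp add: assms)
  next
    case (insert x K)
    moreover have "finsum R ?f K \<in> carrier R"
      using fg by (intro R.finsum_closed) auto
    ultimately show ?case
      using fg by (simp add: Pi_iff assms)
  qed
  then show ?thesis
    by (simp add: poly_eval_def)
qed

section \<open>Evaluation on quaternions and on diagonal matrices\<close>

lemma quat_alg_simps:
  "carrier quat_alg = UNIV" "\<one>\<^bsub>quat_alg\<^esub> = 1" "\<zero>\<^bsub>quat_alg\<^esub> = 0"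
  "x \<otimes>\<^bsub>quat_alg\<^esub> y = x * y" "x \<oplus>\<^bsub>quat_alg\<^esub> y = x + y" "r \<odot>\<^bsub>quat_alg\<^esub> x = r *\<^sub>R x"
  by (simp_all add: quat_alg_def)

lemma word_eval_quat: "word_eval quat_alg a w = prod_list (map a w)"
  by (induction w) (simp_all add: word_eval_def quat_alg_simps)

lemma finsum_quat: "finsum quat_alg f S = sum f S" if "finite S"
proof -
  interpret ring quat_alg
    by (rule ring_quat_alg)
  show ?thesis
    using that by induction (simp_all add: quat_alg_simps)
qed

lemma poly_eval_quat:
  "poly_eval quat_alg p a = (\<Sum>w\<in>Poly_Mapping.keys p. Poly_Mapping.lookup p w *\<^sub>R prod_list (map a w))"
  by (simp add: poly_eval_def finsum_quat word_eval_quat quat_alg_simps)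

text \<open>Diagonal matrices add and multiply entrywise, so each diagonal position evaluates
  \<open>p\<close> separately.\<close>

lemma poly_eval_mat_diag:
  "poly_eval (mat_alg n) p (\<lambda>k. mat_diag n (b k)) = mat_diag n (\<lambda>i. poly_eval quat_alg p (\<lambda>k. b k i))"
proof -
  interpret ring "mat_alg n"
    by (rule ring_mat_alg)
  let ?c = "Poly_Mapping.lookup p"
  have w: "word_eval (mat_alg n) (\<lambda>k. mat_diag n (b k)) w = mat_diag n (\<lambda>i. prod_list (map (\<lambda>k. b k i) w))" for w
    by (induction w) (simp_all add: word_eval_def mat_alg_simps)
  have "finsum (mat_alg n) (\<lambda>w. ?c w \<odot>\<^bsub>mat_alg n\<^esub> word_eval (mat_alg n) (\<lambda>k. mat_diag n (b k)) w) K
      = mat_diag n (\<lambda>i. \<Sum>w\<in>K. ?c w *\<^sub>R prod_list (map (\<lambda>k. b k i) w))" if "finite K" for K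
    using that
  proof induction
    case empty
    then show ?case
      by (auto simp: mat_alg_simps mat_diag_def intro!: eq_matI)
  next
    case (insert x K)
    have "map_mat ((*\<^sub>R) r) (mat_diag n f) + mat_diag n g = mat_diag n (\<lambda>i. r *\<^sub>R f i + g i)" for r and f g :: "nat \<Rightarrow> quat"
      by (rule eq_matI) (auto simp: mat_diag_def)
    with insert show ?case
      by (simp add: Pi_iff w mat_alg_simps)
  qed
  then show ?thesis
    by (simp add: poly_eval_def[of "mat_alg n"] poly_eval_quat)
qed

lemma mult_map_mat_scaleR:
  fixes A B :: "'a :: real_algebra mat"
  assumes "A \<in> carrier_mat n m" "B \<in> carrier_mat m k"
  shows "A * map_mat ((*\<^sub>R) r) B = map_mat ((*\<^sub>R) r) (A * B)" "map_mat ((*\<^sub>R) r) A * B = map_mat ((*\<^sub>R) r) (A * B)"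
  using assms by (auto intro!: eq_matI simp: scalar_prod_def scaleR_sum_right)

lemma poly_image_similar:
  assumes "B \<in> poly_image p (mat_alg n)" "B \<in> carrier_mat n n" "similar_mat A B"
  shows "A \<in> poly_image p (mat_alg n)"
proof -
  obtain P Q where PQ: "P \<in> carrier_mat n n" "Q \<in> carrier_mat n n" "P * Q = 1\<^sub>m n" "Q * P = 1\<^sub>m n" "A = P * B * Q"
    using similar_mat_carrier[OF assms(3,2)] .
  obtain a where a: "B = poly_eval (mat_alg n) p a" "\<And>i. a i \<in> carrier_mat n n"
    using assms(1) by (auto simp: poly_image_def mat_alg_simps)
  have c: "P * M \<in> carrier_mat n n" "P * M * Q \<in> carrier_mat n n" if "M \<in> carrier_mat n n" for M
    using that PQ by (auto intro!: mult_carrier_mat)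
  have "A = poly_eval (mat_alg n) p (\<lambda>i. P * a i * Q)"
    unfolding PQ(5) a(1)
  proof (rule poly_eval_hom[where h = "\<lambda>M. P * M * Q", OF ring_mat_alg ring_mat_alg])
    show "(\<lambda>M. P * M * Q) \<in> carrier (mat_alg n) \<rightarrow> carrier (mat_alg n)"
      using c by (auto simp: mat_alg_simps)
    show "a i \<in> carrier (mat_alg n)" for i
      using a by (simp add: mat_alg_simps)
    show "r \<odot>\<^bsub>mat_alg n\<^esub> M \<in> carrier (mat_alg n)" if "M \<in> carrier (mat_alg n)" for r M
      using that by (simp add: mat_alg_simps)
    show "P * (r \<odot>\<^bsub>mat_alg n\<^esub> M) * Q = r \<odot>\<^bsub>mat_alg n\<^esub> (P * M * Q)" if "M \<in> carrier (mat_alg n)" for r M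
      using that PQ c unfolding mat_alg_simps by (simp only: mult_map_mat_scaleR[of _ n n _ n])
    show "P * (M \<oplus>\<^bsub>mat_alg n\<^esub> N) * Q = P * M * Q \<oplus>\<^bsub>mat_alg n\<^esub> P * N * Q"
      if "M \<in> carrier (mat_alg n)" "N \<in> carrier (mat_alg n)" for M N
      using that PQ c unfolding mat_alg_simps
      by (simp only: mult_add_distrib_mat[of _ n n _ n] add_mult_distrib_mat[of _ n n _ _ n])
    show "P * (M \<otimes>\<^bsub>mat_alg n\<^esub> N) * Q = P * M * Q \<otimes>\<^bsub>mat_alg n\<^esub> (P * N * Q)"
      if "M \<in> carrier (mat_alg n)" "N \<in> carrier (mat_alg n)" for M N
      using that PQ unfolding mat_alg_simps by (intro conj_mult[symmetric])
  qed (use PQ in \<open>simp_all add: mat_alg_simps\<close>)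
  then show ?thesis
    using c a by (auto simp: poly_image_def mat_alg_simps)
qed

text \<open>Only this much of multilinearity is carried forward: each occurring word contains every
  variable from \<open>1\<close> to \<open>m\<close> exactly once.\<close>

lemma multilinear_keys:
  assumes "multilinear p"
  obtains m where "m \<ge> 1" "\<And>w. w \<in> Poly_Mapping.keys p \<Longrightarrow> distinct w \<and> set w = {1..m}"
proof -
  obtain m c where m: "m \<ge> 1"
      "p = (\<Sum>\<sigma> | \<sigma> permutes {1..m}. Poly_Mapping.single (map \<sigma> [1..<Suc m]) (c \<sigma>))"
    using assms unfolding multilinear_def by blast
  have "distinct w \<and> set w = {1..m}" if "w \<in> Poly_Mapping.keys p" for w
  proof -
    have "w \<in> (\<Union>\<sigma>\<in>{\<sigma>. \<sigma> permutes {1..m}}. Poly_Mapping.keys (Poly_Mapping.single (map \<sigma> [1..<Suc m]) (c \<sigma>)))"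
      by (rule subsetD[OF keys_sum that[unfolded m(2)]])
    then obtain \<sigma> where s: "\<sigma> permutes {1..m}" "w = map \<sigma> [1..<Suc m]"
      by (auto split: if_splits)
    have "set [1..<Suc m] = {1..m}"
      by auto
    then show ?thesis
      unfolding s(2) distinct_map set_map using permutes_image[OF s(1)] permutes_inj_on[OF s(1)] by simp
  qed
  then show ?thesis
    using that m(1) by blast
qed

text \<open>The letter \<open>i\<close> occurs once, so the factors before and after it do not
  depend on \<open>x\<close>. This gives linearity in each variable.\<close>

lemma prod_list_update_factor:
  fixes a :: "nat \<Rightarrow> 'a :: monoid_mult"
  assumes "distinct w" "i \<in> set w"
  shows "\<exists>u v. \<forall>x. prod_list (map (a(i := x)) w) = u * x * v"
proof -
  obtain ys zs where w: "w = ys @ i # zs"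
    using assms(2) by (auto dest: split_list)
  have "i \<notin> set ys" "i \<notin> set zs"
    using assms(1) unfolding w by simp_all
  then have "map (a(i := x)) ys = map a ys" "map (a(i := x)) zs = map a zs" for x
    by simp_all
  then have "prod_list (map (a(i := x)) w) = prod_list (map a ys) * x * prod_list (map a zs)" for x
    by (simp only: w list.map map_append prod_list.Cons prod_list.append fun_upd_same mult.assoc)
  then show ?thesis
    by blast
qed

lemma prod_list_conj:
  fixes h :: "'a :: division_ring"
  assumes "h \<noteq> 0"
  shows "prod_list (map (\<lambda>k. h * a k * inverse h) w) = h * prod_list (map a w) * inverse h"
proof (induction w)
  case (Cons i w)
  have "prod_list (map (\<lambda>k. h * a k * inverse h) (i # w)) = h * a i * inverse h * (h * prod_list (map a w) * inverse h)"
    by (simp only: list.map prod_list.Cons Cons)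
  also have "\<dots> = h * a i * (inverse h * h) * prod_list (map a w) * inverse h"
    by (simp only: mult.assoc)
  also have "\<dots> = h * prod_list (map a (i # w)) * inverse h"
    using assms by (simp add: mult.assoc)
  finally show ?case .
qed (use assms in simp)

lemma poly_eval_quat_update:
  assumes "\<And>w. w \<in> Poly_Mapping.keys p \<Longrightarrow> distinct w \<and> set w = I" "i \<in> I"
  shows "poly_eval quat_alg p (a(i := x + y)) = poly_eval quat_alg p (a(i := x)) + poly_eval quat_alg p (a(i := y))"
    and "poly_eval quat_alg p (a(i := r *\<^sub>R x)) = r *\<^sub>R poly_eval quat_alg p (a(i := x))"
proof -
  have "\<exists>u v. \<forall>x. prod_list (map (a(i := x)) w) = u * x * v" if "w \<in> Poly_Mapping.keys p" for w
    using assms that by (intro prod_list_update_factor) auto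
  then obtain u v where uv: "\<And>w x. w \<in> Poly_Mapping.keys p \<Longrightarrow> prod_list (map (a(i := x)) w) = u w * x * v w"
    by metis
  show "poly_eval quat_alg p (a(i := x + y)) = poly_eval quat_alg p (a(i := x)) + poly_eval quat_alg p (a(i := y))"
    by (simp add: poly_eval_quat uv algebra_simps sum.distrib)
  show "poly_eval quat_alg p (a(i := r *\<^sub>R x)) = r *\<^sub>R poly_eval quat_alg p (a(i := x))"
    by (simp add: poly_eval_quat uv scaleR_sum_right mult.commute)
qed

lemma poly_eval_quat_conj:
  assumes "h \<noteq> 0"
  shows "poly_eval quat_alg p (\<lambda>k. h * a k * inverse h) = h * poly_eval quat_alg p a * inverse h"
  by (simp add: poly_eval_quat prod_list_conj[OF assms] sum_distrib_left sum_distrib_right)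

lemma poly_eval_quat_scale_all:
  assumes "\<And>w. w \<in> Poly_Mapping.keys p \<Longrightarrow> distinct w \<and> set w = I"
  shows "poly_eval quat_alg p (\<lambda>k. s k *\<^sub>R a k) = (\<Prod>k\<in>I. s k) *\<^sub>R poly_eval quat_alg p a"
proof -
  have w: "prod_list (map (\<lambda>k. s k *\<^sub>R a k) w) = (\<Prod>k\<in>set w. s k) *\<^sub>R prod_list (map a w)" if "distinct w" for w
    using that by (induction w) (simp_all add: mult.commute)
  show ?thesis
    using assms by (simp add: poly_eval_quat w scaleR_sum_right mult.commute)
qed

lemma poly_eval_quat_cong:
  assumes "\<And>w. w \<in> Poly_Mapping.keys p \<Longrightarrow> set w \<subseteq> I" "\<And>k. k \<in> I \<Longrightarrow> a k = b k"
  shows "poly_eval quat_alg p a = poly_eval quat_alg p b"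
proof -
  have "prod_list (map a w) = prod_list (map b w)" if "w \<in> Poly_Mapping.keys p" for w
    by (rule arg_cong[where f = prod_list], rule map_cong[OF refl]) (use assms that in auto)
  then show ?thesis
    by (simp add: poly_eval_quat)
qed

section \<open>Values on basis quaternions\<close>

definition quat_basis :: "quat set" where
  "quat_basis = {Quat 1 0 0 0, Quat 0 1 0 0, Quat 0 0 1 0, Quat 0 0 0 1}"

text \<open>The variables in \<open>J\<close> are replaced one after another. The value is linear in
  the variable at hand, and real values on the whole basis would make it real, so some basis element
  keeps it nonreal.\<close>

lemma nonreal_value_on_basis:
  assumes "finite J" "J \<subseteq> I" "\<And>w. w \<in> Poly_Mapping.keys p \<Longrightarrow> distinct w \<and> set w = I"
    and "poly_eval quat_alg p a \<notin> \<real>"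
  shows "\<exists>b. (\<forall>k\<in>J. b k \<in> quat_basis) \<and> poly_eval quat_alg p b \<notin> \<real>"
  using assms(1,2)
proof induction
  case empty
  then show ?case
    using assms(4) by auto
next
  case (insert i J)
  then obtain b where b: "\<forall>k\<in>J. b k \<in> quat_basis" "poly_eval quat_alg p b \<notin> \<real>"
    by auto
  define L where "L x = poly_eval quat_alg p (b(i := x))" for x
  have i: "i \<in> I"
    using insert by simp
  have L: "L (x + y) = L x + L y" "L (r *\<^sub>R x) = r *\<^sub>R L x" for x y r
    unfolding L_def by (intro poly_eval_quat_update[where I = I, OF assms(3) i]; assumption)+
  have "b i = qre (b i) *\<^sub>R Quat 1 0 0 0 + qi (b i) *\<^sub>R Quat 0 1 0 0
      + qj (b i) *\<^sub>R Quat 0 0 1 0 + qk (b i) *\<^sub>R Quat 0 0 0 1"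
    by (simp add: quat_eq_iff)
  then have "L (b i) = L \<dots>"
    by (rule arg_cong)
  also have "\<dots> = qre (b i) *\<^sub>R L (Quat 1 0 0 0) + qi (b i) *\<^sub>R L (Quat 0 1 0 0)
      + qj (b i) *\<^sub>R L (Quat 0 0 1 0) + qk (b i) *\<^sub>R L (Quat 0 0 0 1)"
    by (simp only: L)
  finally have expand: "L (b i) = \<dots>" .
  obtain e where e: "e \<in> quat_basis" "L e \<notin> \<real>"
  proof (rule ccontr)
    assume "\<not> thesis"
    with that have "\<And>e. e \<in> quat_basis \<Longrightarrow> L e \<in> \<real>"
      by blast
    then have "L (b i) \<in> \<real>"
      unfolding expand by (simp add: quat_Reals_iff quat_basis_def)
    then show False
      using b by (simp add: L_def)
  qed
  show ?case
  proof (intro exI conjI)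
    show "\<forall>k\<in>insert i J. (b(i := e)) k \<in> quat_basis"
      using b(1) e by simp
    show "poly_eval quat_alg p (b(i := e)) \<notin> \<real>"
      using e(2) unfolding L_def .
  qed
qed

lemma prod_sign:
  fixes s :: "'b \<Rightarrow> 'a :: comm_ring_1"
  assumes "\<And>k. k \<in> I \<Longrightarrow> s k = 1 \<or> s k = -1"
  shows "prod s I = 1 \<or> prod s I = -1"
  using assms
proof (induction I rule: infinite_finite_induct)
  case (insert x I)
  then have "s x = 1 \<or> s x = -1" "prod s I = 1 \<or> prod s I = -1"
    by simp_all
  then show ?case
    using insert.hyps by auto
qed simp_all

text \<open>Conjugation by \<open>i\<close> and by \<open>j\<close> maps each basis quaternion to itself or its negative,
  hence by multilinearity also the value of \<open>p\<close>; the value is then a multiple of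
  a basis quaternion.\<close>

lemma basis_value_pure:
  assumes "\<And>w. w \<in> Poly_Mapping.keys p \<Longrightarrow> distinct w \<and> set w = I"
    and "\<And>k. b k \<in> quat_basis" "poly_eval quat_alg p b \<notin> \<real>"
  shows "qre (poly_eval quat_alg p b) = 0"
proof -
  let ?v = "poly_eval quat_alg p b"
  have sign: "h * ?v * inverse h = ?v \<or> h * ?v * inverse h = - ?v"
    if h: "h = Quat 0 1 0 0 \<or> h = Quat 0 0 1 0" for h
  proof -
    have "h \<noteq> 0"
      using h by (auto simp: quat_eq_iff)
    have "\<exists>s :: real. (s = 1 \<or> s = -1) \<and> h * b k * inverse h = s *\<^sub>R b k" for k
    proof -
      have "h * b k * inverse h = b k \<or> h * b k * inverse h = - b k"
        using h assms(2)[of k] by (auto simp: quat_basis_def quat_eq_iff quat_sel_mult inverse_quat_def)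
      then show ?thesis
        by (metis scaleR_minus1_left scaleR_one)
    qed
    then obtain s :: "nat \<Rightarrow> real" where s: "\<And>k. s k = 1 \<or> s k = -1" "\<And>k. h * b k * inverse h = s k *\<^sub>R b k"
      by metis
    have "h * ?v * inverse h = prod s I *\<^sub>R ?v"
      unfolding poly_eval_quat_conj[OF \<open>h \<noteq> 0\<close>, symmetric] s(2)
      by (rule poly_eval_quat_scale_all) (rule assms(1))
    then show ?thesis
      using prod_sign[of I s] s(1) by auto
  qed
  show ?thesis
    \<comment> \<open>A nonzero real part, being invariant under conjugation, would force the plus
      sign both times; the value would then commute with both quaternions and be real.\<close>
    using sign[of "Quat 0 1 0 0"] sign[of "Quat 0 0 1 0"] assms(3)
    by (auto simp: quat_eq_iff quat_sel_mult inverse_quat_def quat_Reals_iff)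
qed

text \<open>The image is closed under real scaling and conjugation. Were it contained in the reals,
  a nonzero value would scale to all of them, which is excluded. So there is a nonreal value, then
  one on basis quaternions, and this one is pure; \<open>pure_quat_conj\<close> reaches every other
  pure quaternion.\<close>

lemma pure_in_poly_image:
  assumes "multilinear p" "poly_image p quat_alg \<notin> {{0}, \<real>}" "qre d = 0" "d \<noteq> 0"
  shows "d \<in> poly_image p quat_alg"
proof -
  obtain m where m: "m \<ge> 1" "\<And>w. w \<in> Poly_Mapping.keys p \<Longrightarrow> distinct w \<and> set w = {1..m}"
    using multilinear_keys[OF assms(1)] by blast
  have image: "poly_image p quat_alg = range (poly_eval quat_alg p)"
    by (auto simp: poly_image_def quat_alg_simps)
  have one: "1 \<in> {1..m}"
    using m(1) by simp
  have scale: "r *\<^sub>R x \<in> poly_image p quat_alg" if x: "x \<in> poly_image p quat_alg" for r x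
  proof -
    obtain a where "x = poly_eval quat_alg p a"
      using x image by auto
    then have "poly_eval quat_alg p (a(1 := r *\<^sub>R a 1)) = r *\<^sub>R x"
      \<comment> \<open>Scaling the variable \<open>1\<close>, which exists because
        \<open>m \<ge> 1\<close>, scales the value.\<close>
      using poly_eval_quat_update(2)[where I = "{1..m}" and p = p, OF m(2) one, of a r "a 1"] by simp
    then show ?thesis
      unfolding image by (metis rangeI)
  qed
  have "\<not> poly_image p quat_alg \<subseteq> \<real>"
  proof
    assume real: "poly_image p quat_alg \<subseteq> \<real>"
    have "poly_image p quat_alg \<noteq> {}"
      by (simp add: image)
    then obtain x where x: "x \<in> poly_image p quat_alg" "x \<noteq> 0"
      using assms(2) by auto
    then obtain r where r: "x = of_real r"
      using real by (auto elim: Reals_cases)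
    have "(t / r) *\<^sub>R x = of_real t" for t
      using x(2) by (simp add: r quat_of_real quat_eq_iff)
    then have "of_real t \<in> poly_image p quat_alg" for t
      using scale[OF x(1), of "t / r"] by metis
    then have "poly_image p quat_alg = \<real>"
      using real by (auto elim: Reals_cases)
    then show False
      using assms(2) by simp
  qed
  then obtain a where "poly_eval quat_alg p a \<notin> \<real>"
    using image by auto
  then obtain b where b: "\<forall>k\<in>{1..m}. b k \<in> quat_basis" "poly_eval quat_alg p b \<notin> \<real>"
    using nonreal_value_on_basis[of "{1..m}" "{1..m}" p a] m(2) by auto
  \<comment> \<open>Variables outside \<open>{1..m}\<close> get the basis element one, so that all
    variables take basis values while the value of \<open>p\<close> stays the same.\<close>
  define c where "c k = (if k \<in> {1..m} then b k else Quat 1 0 0 0)" for k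
  have cb: "poly_eval quat_alg p c = poly_eval quat_alg p b"
    by (rule poly_eval_quat_cong[of _ "{1..m}"]) (use m(2) in \<open>auto simp: c_def\<close>)
  let ?q = "poly_eval quat_alg p c"
  have q: "?q \<notin> \<real>"
    using b(2) cb by simp
  have "c k \<in> quat_basis" for k
    using b(1) by (auto simp: c_def quat_basis_def)
  then have "qre ?q = 0"
    using basis_value_pure[of p "{1..m}" c] m(2) q by blast
  moreover have "?q \<noteq> 0"
    using q by (metis Reals_0)
  ultimately obtain r h where rh: "h \<noteq> 0" "d = r *\<^sub>R (h * ?q * inverse h)"
    using pure_quat_conj assms(3,4) by blast
  have "h * ?q * inverse h \<in> poly_image p quat_alg"
    unfolding image poly_eval_quat_conj[OF rh(1), symmetric] by blast
  then show ?thesis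
    unfolding rh(2) by (rule scale)
qed

text \<open>Preimages of the diagonal entries are chosen separately and assembled into diagonal
  matrices, one for each variable.\<close>

lemma pure_diagonalizable_in_poly_image:
  assumes "multilinear p" "poly_image p quat_alg \<notin> {{0}, \<real>}" "pure_diagonalizable n X"
  shows "X \<in> poly_image p (mat_alg n)"
proof -
  obtain d where d: "\<And>i. d i \<noteq> 0" "\<And>i. qre (d i) = 0" "similar_mat X (mat_diag n d)"
    using assms(3) by (auto simp: pure_diagonalizable_def)
  have "\<exists>b. d i = poly_eval quat_alg p b" for i
    using pure_in_poly_image[OF assms(1,2) d(2,1), of i] by (auto simp: poly_image_def)
  then obtain b where "\<And>i. d i = poly_eval quat_alg p (b i)"
    by metis
  then have "d = (\<lambda>i. poly_eval quat_alg p (b i))"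
    by (rule ext)
  then have "mat_diag n d = poly_eval (mat_alg n) p (\<lambda>k. mat_diag n (\<lambda>i. b i k))"
    by (simp add: poly_eval_mat_diag)
  then have "mat_diag n d \<in> poly_image p (mat_alg n)"
    by (auto simp: poly_image_def mat_alg_simps)
  then show ?thesis
    using poly_image_similar d(3) mat_diag_dim by blast
qed

section \<open>Assembling the two statements\<close>

lemma mat_alg_minus:
  assumes "A \<in> carrier_mat n n" "B \<in> carrier_mat n n"
  shows "A \<ominus>\<^bsub>mat_alg n\<^esub> B = A - B"
proof -
  interpret ring "mat_alg n"
    by (rule ring_mat_alg)
  have "\<ominus>\<^bsub>mat_alg n\<^esub> B = - B"
    by (rule minus_equality) (use assms in \<open>auto simp: mat_alg_simps\<close>)
  then show ?thesis
    using assms by (auto simp: a_minus_def mat_alg_simps intro!: eq_matI)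
qed

text \<open>The offset \<open>k\<close> is \<open>0\<close> for the first product of commutators and
  \<open>4\<close> for the second.\<close>

lemma two_pure_commutators_indexed:
  fixes k :: nat
  assumes "M \<in> carrier_mat n n" "n > 0" "ddet M = 1"
  shows "\<exists>A. (\<forall>i\<in>{k + 1..k + 4}. pure_diagonalizable n (A i) \<and> A i \<in> Units (mat_alg n)) \<and>
    M = A (k + 1) \<otimes>\<^bsub>mat_alg n\<^esub> A (k + 2) \<otimes>\<^bsub>mat_alg n\<^esub> inv\<^bsub>mat_alg n\<^esub> A (k + 1) \<otimes>\<^bsub>mat_alg n\<^esub> inv\<^bsub>mat_alg n\<^esub> A (k + 2)
      \<otimes>\<^bsub>mat_alg n\<^esub> A (k + 3) \<otimes>\<^bsub>mat_alg n\<^esub> A (k + 4) \<otimes>\<^bsub>mat_alg n\<^esub> inv\<^bsub>mat_alg n\<^esub> A (k + 3) \<otimes>\<^bsub>mat_alg n\<^esub> inv\<^bsub>mat_alg n\<^esub> A (k + 4)"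
proof -
  obtain X Y Z W where XYZW: "\<forall>M\<in>{X, Y, Z, W}. pure_diagonalizable n M \<and> M \<in> Units (mat_alg n)"
    "M = X \<otimes>\<^bsub>mat_alg n\<^esub> Y \<otimes>\<^bsub>mat_alg n\<^esub> inv\<^bsub>mat_alg n\<^esub> X \<otimes>\<^bsub>mat_alg n\<^esub> inv\<^bsub>mat_alg n\<^esub> Y
      \<otimes>\<^bsub>mat_alg n\<^esub> Z \<otimes>\<^bsub>mat_alg n\<^esub> W \<otimes>\<^bsub>mat_alg n\<^esub> inv\<^bsub>mat_alg n\<^esub> Z \<otimes>\<^bsub>mat_alg n\<^esub> inv\<^bsub>mat_alg n\<^esub> W"
    using two_pure_commutators[OF assms] by blast
  define A where "A i = (if i = k + 1 then X else if i = k + 2 then Y else if i = k + 3 then Z else W)" for i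
  have "A (k + 1) = X" "A (k + 2) = Y" "A (k + 3) = Z" "A (k + 4) = W"
    by (simp_all add: A_def)
  moreover have "\<forall>i\<in>{k + 1..k + 4}. pure_diagonalizable n (A i) \<and> A i \<in> Units (mat_alg n)"
    using XYZW(1) by (simp add: A_def)
  ultimately show ?thesis
    using XYZW(2) by (intro exI[of _ A]) simp
qed

theorem theorem50:
  fixes n :: nat
  assumes "n \<ge> 2"
  shows
    "(\<forall>p :: nat \<Rightarrow> free_alg.
        (\<forall>i\<in>{1..4}. multilinear (p i) \<and> poly_image (p i) quat_alg \<notin> {{0}, \<real>}) \<longrightarrow>
        SL n \<subseteq>
          {A 1 \<otimes>\<^bsub>mat_alg n\<^esub> A 2 \<otimes>\<^bsub>mat_alg n\<^esub> inv\<^bsub>mat_alg n\<^esub> A 1 \<otimes>\<^bsub>mat_alg n\<^esub> inv\<^bsub>mat_alg n\<^esub> A 2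
             \<otimes>\<^bsub>mat_alg n\<^esub> A 3 \<otimes>\<^bsub>mat_alg n\<^esub> A 4 \<otimes>\<^bsub>mat_alg n\<^esub> inv\<^bsub>mat_alg n\<^esub> A 3 \<otimes>\<^bsub>mat_alg n\<^esub> inv\<^bsub>mat_alg n\<^esub> A 4
           | A :: nat \<Rightarrow> quat mat.
               \<forall>i\<in>{1..4}. A i \<in> poly_image (p i) (mat_alg n) \<and> A i \<in> Units (mat_alg n)})
     \<and>
     (\<forall>p :: nat \<Rightarrow> free_alg.
        (\<forall>i\<in>{1..8}. multilinear (p i) \<and> poly_image (p i) quat_alg \<notin> {{0}, \<real>}) \<longrightarrow>
        (\<forall>B\<in>carrier (mat_alg n). \<exists>A :: nat \<Rightarrow> quat mat.
           (\<forall>i\<in>{1..8}. A i \<in> poly_image (p i) (mat_alg n) \<and> A i \<in> Units (mat_alg n)) \<and>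
           B = (A 1 \<otimes>\<^bsub>mat_alg n\<^esub> A 2 \<otimes>\<^bsub>mat_alg n\<^esub> inv\<^bsub>mat_alg n\<^esub> A 1 \<otimes>\<^bsub>mat_alg n\<^esub> inv\<^bsub>mat_alg n\<^esub> A 2
                  \<otimes>\<^bsub>mat_alg n\<^esub> A 3 \<otimes>\<^bsub>mat_alg n\<^esub> A 4 \<otimes>\<^bsub>mat_alg n\<^esub> inv\<^bsub>mat_alg n\<^esub> A 3 \<otimes>\<^bsub>mat_alg n\<^esub> inv\<^bsub>mat_alg n\<^esub> A 4)
               \<ominus>\<^bsub>mat_alg n\<^esub>
               (A 5 \<otimes>\<^bsub>mat_alg n\<^esub> A 6 \<otimes>\<^bsub>mat_alg n\<^esub> inv\<^bsub>mat_alg n\<^esub> A 5 \<otimes>\<^bsub>mat_alg n\<^esub> inv\<^bsub>mat_alg n\<^esub> A 6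
                  \<otimes>\<^bsub>mat_alg n\<^esub> A 7 \<otimes>\<^bsub>mat_alg n\<^esub> A 8 \<otimes>\<^bsub>mat_alg n\<^esub> inv\<^bsub>mat_alg n\<^esub> A 7 \<otimes>\<^bsub>mat_alg n\<^esub> inv\<^bsub>mat_alg n\<^esub> A 8)))"
proof (intro conjI allI impI)
  have n: "n > 0"
    using assms by simp
  fix p :: "nat \<Rightarrow> free_alg"
  assume p: "\<forall>i\<in>{1..4}. multilinear (p i) \<and> poly_image (p i) quat_alg \<notin> {{0}, \<real>}"
  show "SL n \<subseteq>
          {A 1 \<otimes>\<^bsub>mat_alg n\<^esub> A 2 \<otimes>\<^bsub>mat_alg n\<^esub> inv\<^bsub>mat_alg n\<^esub> A 1 \<otimes>\<^bsub>mat_alg n\<^esub> inv\<^bsub>mat_alg n\<^esub> A 2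
             \<otimes>\<^bsub>mat_alg n\<^esub> A 3 \<otimes>\<^bsub>mat_alg n\<^esub> A 4 \<otimes>\<^bsub>mat_alg n\<^esub> inv\<^bsub>mat_alg n\<^esub> A 3 \<otimes>\<^bsub>mat_alg n\<^esub> inv\<^bsub>mat_alg n\<^esub> A 4
           | A :: nat \<Rightarrow> quat mat.
               \<forall>i\<in>{1..4}. A i \<in> poly_image (p i) (mat_alg n) \<and> A i \<in> Units (mat_alg n)}"
  proof
    fix M assume "M \<in> SL n"
    then have M: "M \<in> carrier_mat n n" "ddet M = 1"
      using SL_ddet by auto
    obtain A :: "nat \<Rightarrow> quat mat" where A: "\<And>i. i \<in> {1..4} \<Longrightarrow> pure_diagonalizable n (A i) \<and> A i \<in> Units (mat_alg n)"
      and M_eq: "M = A 1 \<otimes>\<^bsub>mat_alg n\<^esub> A 2 \<otimes>\<^bsub>mat_alg n\<^esub> inv\<^bsub>mat_alg n\<^esub> A 1 \<otimes>\<^bsub>mat_alg n\<^esub> inv\<^bsub>mat_alg n\<^esub> A 2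
             \<otimes>\<^bsub>mat_alg n\<^esub> A 3 \<otimes>\<^bsub>mat_alg n\<^esub> A 4 \<otimes>\<^bsub>mat_alg n\<^esub> inv\<^bsub>mat_alg n\<^esub> A 3 \<otimes>\<^bsub>mat_alg n\<^esub> inv\<^bsub>mat_alg n\<^esub> A 4"
      using two_pure_commutators_indexed[OF M(1) n M(2), of 0, unfolded add_0] by (elim exE conjE) (rule that, blast)
    have "\<forall>i\<in>{1..4}. A i \<in> poly_image (p i) (mat_alg n) \<and> A i \<in> Units (mat_alg n)"
      using A p pure_diagonalizable_in_poly_image by blast
    with M_eq show "M \<in> {A 1 \<otimes>\<^bsub>mat_alg n\<^esub> A 2 \<otimes>\<^bsub>mat_alg n\<^esub> inv\<^bsub>mat_alg n\<^esub> A 1 \<otimes>\<^bsub>mat_alg n\<^esub> inv\<^bsub>mat_alg n\<^esub> A 2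
             \<otimes>\<^bsub>mat_alg n\<^esub> A 3 \<otimes>\<^bsub>mat_alg n\<^esub> A 4 \<otimes>\<^bsub>mat_alg n\<^esub> inv\<^bsub>mat_alg n\<^esub> A 3 \<otimes>\<^bsub>mat_alg n\<^esub> inv\<^bsub>mat_alg n\<^esub> A 4
           | A :: nat \<Rightarrow> quat mat.
               \<forall>i\<in>{1..4}. A i \<in> poly_image (p i) (mat_alg n) \<and> A i \<in> Units (mat_alg n)}"
      by blast
  qed
next
  have n: "n > 0"
    using assms by simp
  fix p :: "nat \<Rightarrow> free_alg"
  assume p: "\<forall>i\<in>{1..8}. multilinear (p i) \<and> poly_image (p i) quat_alg \<notin> {{0}, \<real>}"
  show "\<forall>B\<in>carrier (mat_alg n). \<exists>A :: nat \<Rightarrow> quat mat.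
           (\<forall>i\<in>{1..8}. A i \<in> poly_image (p i) (mat_alg n) \<and> A i \<in> Units (mat_alg n)) \<and>
           B = (A 1 \<otimes>\<^bsub>mat_alg n\<^esub> A 2 \<otimes>\<^bsub>mat_alg n\<^esub> inv\<^bsub>mat_alg n\<^esub> A 1 \<otimes>\<^bsub>mat_alg n\<^esub> inv\<^bsub>mat_alg n\<^esub> A 2
                  \<otimes>\<^bsub>mat_alg n\<^esub> A 3 \<otimes>\<^bsub>mat_alg n\<^esub> A 4 \<otimes>\<^bsub>mat_alg n\<^esub> inv\<^bsub>mat_alg n\<^esub> A 3 \<otimes>\<^bsub>mat_alg n\<^esub> inv\<^bsub>mat_alg n\<^esub> A 4)
               \<ominus>\<^bsub>mat_alg n\<^esub>
               (A 5 \<otimes>\<^bsub>mat_alg n\<^esub> A 6 \<otimes>\<^bsub>mat_alg n\<^esub> inv\<^bsub>mat_alg n\<^esub> A 5 \<otimes>\<^bsub>mat_alg n\<^esub> inv\<^bsub>mat_alg n\<^esub> A 6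
                  \<otimes>\<^bsub>mat_alg n\<^esub> A 7 \<otimes>\<^bsub>mat_alg n\<^esub> A 8 \<otimes>\<^bsub>mat_alg n\<^esub> inv\<^bsub>mat_alg n\<^esub> A 7 \<otimes>\<^bsub>mat_alg n\<^esub> inv\<^bsub>mat_alg n\<^esub> A 8)"
  proof
    fix B assume "B \<in> carrier (mat_alg n)"
    then obtain C D where CD: "C \<in> carrier_mat n n" "D \<in> carrier_mat n n" "ddet C = 1" "ddet D = 1" "B = C - D"
      using difference_of_ddet_one[of B n] assms by (auto simp: mat_alg_simps)
    obtain E :: "nat \<Rightarrow> quat mat" where E: "\<And>i. i \<in> {1..4} \<Longrightarrow> pure_diagonalizable n (E i) \<and> E i \<in> Units (mat_alg n)"
      "C = E 1 \<otimes>\<^bsub>mat_alg n\<^esub> E 2 \<otimes>\<^bsub>mat_alg n\<^esub> inv\<^bsub>mat_alg n\<^esub> E 1 \<otimes>\<^bsub>mat_alg n\<^esub> inv\<^bsub>mat_alg n\<^esub> E 2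
             \<otimes>\<^bsub>mat_alg n\<^esub> E 3 \<otimes>\<^bsub>mat_alg n\<^esub> E 4 \<otimes>\<^bsub>mat_alg n\<^esub> inv\<^bsub>mat_alg n\<^esub> E 3 \<otimes>\<^bsub>mat_alg n\<^esub> inv\<^bsub>mat_alg n\<^esub> E 4"
      using two_pure_commutators_indexed[OF CD(1) n CD(3), of 0, unfolded add_0] by (elim exE conjE) (rule that, blast)
    obtain F :: "nat \<Rightarrow> quat mat" where F: "\<And>i. i \<in> {5..8} \<Longrightarrow> pure_diagonalizable n (F i) \<and> F i \<in> Units (mat_alg n)"
      "D = F 5 \<otimes>\<^bsub>mat_alg n\<^esub> F 6 \<otimes>\<^bsub>mat_alg n\<^esub> inv\<^bsub>mat_alg n\<^esub> F 5 \<otimes>\<^bsub>mat_alg n\<^esub> inv\<^bsub>mat_alg n\<^esub> F 6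
             \<otimes>\<^bsub>mat_alg n\<^esub> F 7 \<otimes>\<^bsub>mat_alg n\<^esub> F 8 \<otimes>\<^bsub>mat_alg n\<^esub> inv\<^bsub>mat_alg n\<^esub> F 7 \<otimes>\<^bsub>mat_alg n\<^esub> inv\<^bsub>mat_alg n\<^esub> F 8"
      using two_pure_commutators_indexed[OF CD(2) n CD(4), of 4] by (elim exE conjE) (rule that, simp_all)
    \<comment> \<open>The two families live on disjoint index ranges and are merged into
      one.\<close>
    define A where "A i = (if i \<le> 4 then E i else F i)" for i
    have "pure_diagonalizable n (A i) \<and> A i \<in> Units (mat_alg n)" if "i \<in> {1..8}" for i
      using E(1)[of i] F(1)[of i] that by (auto simp: A_def)
    then have "\<forall>i\<in>{1..8}. A i \<in> poly_image (p i) (mat_alg n) \<and> A i \<in> Units (mat_alg n)"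
      using p pure_diagonalizable_in_poly_image by blast
    moreover have "B = C \<ominus>\<^bsub>mat_alg n\<^esub> D"
      using CD by (simp add: mat_alg_minus)
    ultimately show "\<exists>A :: nat \<Rightarrow> quat mat.
           (\<forall>i\<in>{1..8}. A i \<in> poly_image (p i) (mat_alg n) \<and> A i \<in> Units (mat_alg n)) \<and>
           B = (A 1 \<otimes>\<^bsub>mat_alg n\<^esub> A 2 \<otimes>\<^bsub>mat_alg n\<^esub> inv\<^bsub>mat_alg n\<^esub> A 1 \<otimes>\<^bsub>mat_alg n\<^esub> inv\<^bsub>mat_alg n\<^esub> A 2
                  \<otimes>\<^bsub>mat_alg n\<^esub> A 3 \<otimes>\<^bsub>mat_alg n\<^esub> A 4 \<otimes>\<^bsub>mat_alg n\<^esub> inv\<^bsub>mat_alg n\<^esub> A 3 \<otimes>\<^bsub>mat_alg n\<^esub> inv\<^bsub>mat_alg n\<^esub> A 4)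
               \<ominus>\<^bsub>mat_alg n\<^esub>
               (A 5 \<otimes>\<^bsub>mat_alg n\<^esub> A 6 \<otimes>\<^bsub>mat_alg n\<^esub> inv\<^bsub>mat_alg n\<^esub> A 5 \<otimes>\<^bsub>mat_alg n\<^esub> inv\<^bsub>mat_alg n\<^esub> A 6
                  \<otimes>\<^bsub>mat_alg n\<^esub> A 7 \<otimes>\<^bsub>mat_alg n\<^esub> A 8 \<otimes>\<^bsub>mat_alg n\<^esub> inv\<^bsub>mat_alg n\<^esub> A 7 \<otimes>\<^bsub>mat_alg n\<^esub> inv\<^bsub>mat_alg n\<^esub> A 8)"
      unfolding E(2) F(2) by (intro exI[of _ A]) (simp add: A_def)
  qed
qed

end
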